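(* Let $X$ be a discrete random variable and let $Y$ be a random variable jointly distributed with $X$. Let $k\in\{1,2,3,\ldots\}$ and $\alpha\in(0,1)\cup(1,\infty)$. If $\log k\le H_\alpha(X|Y)<\log(k+1)$, then $$\varepsilon_{X|Y}\le\frac{\exp\left(\frac{1-\alpha}{\alpha}H_\alpha(X|Y)\right)-k^{\frac1\alpha+1}+(k-1)(k+1)^{\frac1\alpha}}{k(k+1)^{\frac1\alpha}-k^{\frac1\alpha}(k+1)}.$$ Furthermore, this upper bound on $\varepsilon_{X|Y}$ as a function of $H_\alpha(X|Y)$ is asymptotically tight in the limit $\alpha\to\infty$; that is, for fixed $(X,Y)$, the right side, evaluated with $k=k(\alpha)$ the positive integer such that $\log k\le H_\alpha(X|Y)<\log(k+1)$, converges to $\varepsilon_{X|Y}$ as $\alpha\to\infty$.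
   Context: Logarithms have an arbitrary fixed base larger than 1 and $\exp$ is the inverse of $\log$. $X$ takes values in a discrete (finite or countably infinite) set $\mathcal{X}$ and $Y$ in an arbitrary observation space $\mathcal{Y}$. The Arimoto-R\'enyi conditional entropy of order $\alpha\in(0,1)\cup(1,\infty)$ is $$H_\alpha(X|Y)=\frac{\alpha}{1-\alpha}\log\mathbb{E}\left[\Bigl(\sum_{x\in\mathcal{X}}P_{X|Y}^\alpha(x|Y)\Bigr)^{1/\alpha}\right],$$ the expectation being over $Y\sim P_Y$. The minimum error probability of guessing $X$ from $Y$ is $\varepsilon_{X|Y}=\min_{\mathcal{L}\colon\mathcal{Y}\to\mathcal{X}}\mathbb{P}[X\ne\mathcal{L}(Y)]=1-\mathbb{E}[\max_{x\in\mathcal{X}}P_{X|Y}(x|Y)]$. *)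

theory Defs
  imports "HOL-Probability.Probability"
begin

text \<open>
  \<open>X\<close> takes values in a countable set \<open>A\<close>, \<open>Y\<close> in an arbitrary measurable space \<open>N\<close>.
  The term \<open>cond_prob_given M N X Y x\<close> is the random variable \<open>P\<^sub>X\<^sub>|\<^sub>Y(x|Y)\<close>, i.e. the
  conditional expectation of the indicator of \<open>X = x\<close> given the sigma-algebra generated
  by \<open>Y\<close>. It is determined up to null sets, so the expectations below do not
  depend on the version.
\<close>

definition cond_prob_given ::
  "'a measure \<Rightarrow> 'y measure \<Rightarrow> ('a \<Rightarrow> 'x) \<Rightarrow> ('a \<Rightarrow> 'y) \<Rightarrow> 'x \<Rightarrow> 'a \<Rightarrow> real" where
  "cond_prob_given M N X Y x =
     real_cond_exp M (vimage_algebra (space M) Y N) (indicator {\<omega> \<in> space M. X \<omega> = x})"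

text \<open>
  For \<open>\<alpha> < 1\<close> and infinite \<open>A\<close> the sum over \<open>A\<close> and its expectation may be infinite, so
  both are taken in \<open>ennreal\<close>, and the entropy takes values in \<open>ereal\<close>. The
  exponent \<open>p\<close> below is meant to be positive.
\<close>

definition ennreal_powr :: "ennreal \<Rightarrow> real \<Rightarrow> ennreal" where
  "ennreal_powr x p = (if x = \<infinity> then \<infinity> else ennreal (enn2real x powr p))"

definition ennreal_log :: "real \<Rightarrow> ennreal \<Rightarrow> ereal" where
  "ennreal_log b x =
     (if x = 0 then -\<infinity> else if x = \<infinity> then \<infinity> else ereal (log b (enn2real x)))"

definition arimoto_renyi_cond_entropy ::
  "real \<Rightarrow> 'a measure \<Rightarrow> 'x set \<Rightarrow> 'y measure \<Rightarrow> real \<Rightarrow> ('a \<Rightarrow> 'x) \<Rightarrow> ('a \<Rightarrow> 'y) \<Rightarrow> ereal" where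
  "arimoto_renyi_cond_entropy b M A N \<alpha> X Y =
     ereal (\<alpha> / (1 - \<alpha>)) *
     ennreal_log b
       (\<integral>\<^sup>+ \<omega>. ennreal_powr (\<Sum>\<^sub>\<infinity>x\<in>A. ennreal (cond_prob_given M N X Y x \<omega> powr \<alpha>)) (1 / \<alpha>) \<partial>M)"

text \<open>
  The infimum is over all measurable estimators and is a minimum: choosing a value of
  maximal conditional probability, with ties broken along an enumeration of \<open>A\<close>,
  attains it.
\<close>

definition min_error_prob ::
  "'a measure \<Rightarrow> 'x set \<Rightarrow> 'y measure \<Rightarrow> ('a \<Rightarrow> 'x) \<Rightarrow> ('a \<Rightarrow> 'y) \<Rightarrow> real" where
  "min_error_prob M A N X Y =
     (INF L \<in> N \<rightarrow>\<^sub>M count_space A. measure M {\<omega> \<in> space M. X \<omega> \<noteq> L (Y \<omega>)})"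

definition entropy_error_bound :: "real \<Rightarrow> real \<Rightarrow> nat \<Rightarrow> real \<Rightarrow> real" where
  "entropy_error_bound b \<alpha> k h =
     (b powr ((1 - \<alpha>) / \<alpha> * h) - real k powr (1 / \<alpha> + 1)
        + (real k - 1) * (real k + 1) powr (1 / \<alpha>))
     / (real k * (real k + 1) powr (1 / \<alpha>) - real k powr (1 / \<alpha>) * (real k + 1))"

end

theory Submission
  imports Defs
begin

text \<open>
  Write \<open>p\<close> for the conditional distribution of \<open>X\<close> at a point, \<open>m\<close> for its maximum and
  \<open>\<parallel>p\<parallel>\<close> for its \<open>\<alpha>\<close>-norm, so that the error probability is \<open>1 - E m\<close> and the exponential in
  the bound is \<open>E \<parallel>p\<parallel>\<close>. Pointwise, \<open>\<parallel>p\<parallel>\<close> is at most (for \<open>\<alpha> > 1\<close>) or at least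
  (for \<open>\<alpha> < 1\<close>) an affine function of \<open>m\<close>, namely the one that agrees with \<open>\<parallel>p\<parallel>\<close> for the
  uniform distributions on \<open>k\<close> and on \<open>k + 1\<close> points. Integrating and solving for \<open>1 - E m\<close>
  gives the bound for every \<open>k\<close>. As \<open>\<alpha> \<rightarrow> \<infinity>\<close> this affine function tends to \<open>m\<close>;
  with \<open>k = 1\<close> and \<open>m \<le> \<parallel>p\<parallel>\<close> this gives \<open>E \<parallel>p\<parallel> \<rightarrow> E m\<close>, and hence convergence of the bound
  for each fixed \<open>k\<close>. Only finitely many \<open>k\<close> occur for large \<open>\<alpha>\<close>, because \<open>E m > 0\<close> bounds
  the entropy.
\<close>

subsection \<open>Norms of probability vectors with a given maximum\<close>

text \<open>Convexity cleared of denominators, so that \<open>x = z\<close> is allowed and the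
  inequality can be solved for any of the three values.\<close>

lemma convex_on_three_points:
  fixes f :: "real \<Rightarrow> real"
  assumes "convex_on I f" "x \<in> I" "z \<in> I" "x \<le> y" "y \<le> z"
  shows "f y * (z - x) \<le> f x * (z - y) + f z * (y - x)"
proof (cases "x = z")
  case False
  then have "x < z" using assms by simp
  define u where "u = (z - y) / (z - x)"
  define v where "v = (y - x) / (z - x)"
  have uv: "0 \<le> u" "0 \<le> v" "u + v = 1"
    using assms \<open>x < z\<close> by (auto simp: u_def v_def simp flip: add_divide_distrib)
  have uv_mult: "u * (z - x) = z - y" "v * (z - x) = y - x"
    using \<open>x < z\<close> by (simp_all add: u_def v_def nonzero_mult_div_cancel_right)
  then have "(u * x + v * z) * (z - x) = y * (z - x)" by algebra
  then have "u * x + v * z = y" using \<open>x < z\<close> by simp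
  with assms uv have "f y \<le> u * f x + v * f z"
    unfolding convex_on_def real_scaleR_def by metis
  then have "f y * (z - x) \<le> (u * f x + v * f z) * (z - x)"
    using \<open>x < z\<close> by (intro mult_right_mono) auto
  also have "\<dots> = f x * (z - y) + f z * (y - x)"
    using uv_mult by algebra
  finally show ?thesis .
qed (use assms in auto)

text \<open>One node lies between \<open>x\<close> and the other node; the three-point inequality at
  that node is solved for \<open>f x\<close>.\<close>

lemma convex_on_chord_outside:
  fixes f :: "real \<Rightarrow> real"
  assumes "convex_on I f" "a \<in> I" "b \<in> I" "x \<in> I" "a \<le> b" "x \<le> a \<or> b \<le> x"
  shows "f a * (b - x) + f b * (x - a) \<le> f x * (b - a)"
  using assms(6)
proof
  assume "x \<le> a"
  from convex_on_three_points[OF assms(1,4,3) this assms(5)] show ?thesis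
    by (simp add: algebra_simps)
next
  assume "b \<le> x"
  from convex_on_three_points[OF assms(1,2,4) assms(5) this] show ?thesis
    by (simp add: algebra_simps)
qed

text \<open>The second derivative has the sign of \<open>c * (p * (p - 1))\<close>. The factor
  \<open>c\<close> will be a sign, so that convex and concave powers are treated at once.\<close>

lemma convex_on_mult_powr_pos:
  fixes c p :: real
  assumes "0 \<le> c * (p * (p - 1))"
  shows "convex_on {0<..} (\<lambda>x. c * x powr p)"
proof (rule f''_ge0_imp_convex)
  show "((\<lambda>x. c * x powr p) has_real_derivative c * (p * x powr (p - 1))) (at x)"
    if "x \<in> {0<..}" for x using that by (auto intro!: derivative_eq_intros)
  show "((\<lambda>x. c * (p * x powr (p - 1))) has_real_derivative
      (c * (p * (p - 1))) * x powr (p - 1 - 1)) (at x)"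
    if "x \<in> {0<..}" for x using that by (auto intro!: derivative_eq_intros)
  show "0 \<le> (c * (p * (p - 1))) * x powr (p - 1 - 1)" for x
    by (rule mult_nonneg_nonneg[OF assms]) simp
qed auto

text \<open>Entries of a probability vector may vanish, so \<open>0\<close> has to be in the domain.
  A segment that starts at \<open>0\<close> reduces to comparing \<open>t powr p\<close> with
  \<open>t\<close>.\<close>

lemma convex_on_mult_powr_nonneg:
  fixes c p :: real
  assumes "0 < p" "0 \<le> c * (p - 1)"
  shows "convex_on {0..} (\<lambda>x. c * x powr p)"
proof (rule convex_on_linorderI)
  fix t x y :: real
  assume t: "0 < t" "t < 1" and xy: "x \<in> {0..}" "y \<in> {0..}" "x < y"
  show "c * ((1 - t) *\<^sub>R x + t *\<^sub>R y) powr p \<le> (1 - t) * (c * x powr p) + t * (c * y powr p)"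
  proof (cases "x = 0")
    case True
    have "c * t powr p \<le> c * t"
    proof (cases p "1::real" rule: linorder_cases)
      case greater
      then have "c \<ge> 0" using assms by (auto simp: zero_le_mult_iff)
      then show ?thesis using greater t powr_mono'[of 1 p t] by (auto intro!: mult_left_mono)
    next
      case less
      then have "c \<le> 0" using assms by (auto simp: zero_le_mult_iff)
      then show ?thesis using less t powr_mono'[of p 1 t] by (auto intro!: mult_left_mono_neg)
    qed (use t in simp)
    then have "c * t powr p * y powr p \<le> c * t * y powr p" by (intro mult_right_mono) auto
    then show ?thesis using True t xy by (simp add: powr_mult algebra_simps)
  next
    case False
    have "convex_on {0<..} (\<lambda>x. c * x powr p)"
      using assms mult_nonneg_nonneg[of p "c * (p - 1)"]
      by (intro convex_on_mult_powr_pos) (simp add: algebra_simps)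
    from convex_onD[OF this, of t x y] show ?thesis using False t xy by auto
  qed
qed auto

text \<open>As \<open>f 0 = 0\<close>, on \<open>[0, m]\<close> the function lies below the line
  through the origin of slope \<open>f m / m\<close>, and the entries sum to
  \<open>1\<close>.\<close>

lemma has_sum_convex_le:
  fixes f :: "real \<Rightarrow> real" and p :: "'a \<Rightarrow> real"
  assumes f: "convex_on {0..} f" "f 0 = 0"
    and p: "\<And>x. x \<in> A \<Longrightarrow> 0 \<le> p x" "\<And>x. x \<in> A \<Longrightarrow> p x \<le> m" "0 < m" "(p has_sum 1) A"
    and S: "((\<lambda>x. f (p x)) has_sum S) A"
  shows "S \<le> f m / m"
proof (rule has_sum_mono[OF S])
  show "((\<lambda>x. p x * (f m / m)) has_sum f m / m) A"
    using has_sum_cmult_left[OF p(4), of "f m / m"] by simp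
  show "f (p x) \<le> p x * (f m / m)" if "x \<in> A" for x
    using convex_on_three_points[OF f(1), of 0 m "p x"] p(1,2)[OF that] p(3) f(2)
    by (simp add: field_simps)
qed

text \<open>
  The extremal vector is \<open>(m, \<dots>, m, r, 0, \<dots>)\<close>, because the piecewise linear
  interpolation of \<open>f\<close> at \<open>0, r, m\<close> has the form
  \<open>a x + c max 0 (x - r)\<close> with \<open>c \<ge> 0\<close>.
\<close>

lemma has_sum_convex_le_extremal:
  fixes f :: "real \<Rightarrow> real" and p :: "'a \<Rightarrow> real" and k :: nat
  assumes f: "convex_on {0..} f" "f 0 = 0"
    and p: "\<And>x. x \<in> A \<Longrightarrow> 0 \<le> p x" "\<And>x. x \<in> A \<Longrightarrow> p x \<le> m" "(p has_sum 1) A"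
    and r: "r = 1 - real k * m" "0 < r" "r < m"
    and S: "((\<lambda>x. f (p x)) has_sum S) A"
  shows "S \<le> real k * f m + f r"
proof -
  define a where "a = f r / r"
  define c where "c = (f m - f r) / (m - r) - a"
  have ar: "a * r = f r" using r by (simp add: a_def)
  have cr: "(c + a) * (m - r) = f m - f r" using r by (simp add: c_def)
  have fm: "f m = a * r + (c + a) * (m - r)" by (simp add: ar cr)
  have "f r * m \<le> f m * r"
    using convex_on_three_points[OF f(1), of 0 m r] r(2,3) f(2) by simp
  then have c0: "0 \<le> c"
    using r(2,3) by (simp add: c_def a_def field_simps)
  have le: "f y \<le> a * y + c * max 0 (y - r)" if "0 \<le> y" "y \<le> m" for y
  proof (cases "y \<le> r")
    case True
    have "f y * r \<le> f r * y"
      using convex_on_three_points[OF f(1), of 0 r y] r(2,3) f(2) True that by simp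
    then have "f y \<le> a * y" using r(2) by (simp add: a_def field_simps)
    then show ?thesis using True by simp
  next
    case False
    have "f y * (m - r) \<le> f r * (m - y) + f m * (y - r)"
      using convex_on_three_points[OF f(1), of r m y] r(2,3) False that by simp
    also have "\<dots> = (a * y + c * (y - r)) * (m - r)"
      unfolding ar[symmetric] fm by (simp add: algebra_simps)
    finally show ?thesis using r False by simp
  qed
  \<comment> \<open>At most \<open>k\<close> entries above \<open>r\<close> contribute at most
    \<open>m - r\<close> each. More than \<open>k\<close> of them have total mass at most
    \<open>1\<close>, from which at least \<open>(k + 1) * r\<close> is subtracted; this is the same
    bound because \<open>1 - k * m = r\<close>.\<close>
  have fin: "(\<Sum>x\<in>F. max 0 (p x - r)) \<le> real k * (m - r)" if F: "finite F" "F \<subseteq> A" for F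
  proof -
    define T where "T = {x \<in> F. r < p x}"
    have T: "finite T" "T \<subseteq> A" using F by (auto simp: T_def)
    have "(\<Sum>x\<in>F. max 0 (p x - r)) = (\<Sum>x\<in>T. p x - r)"
      unfolding T_def using F by (intro sum.mono_neutral_cong_right) auto
    also have "\<dots> \<le> real k * (m - r)"
    proof (cases "card T \<le> k")
      case True
      have "(\<Sum>x\<in>T. p x - r) \<le> (\<Sum>x\<in>T. m - r)" using T p(2) by (intro sum_mono) auto
      also have "\<dots> \<le> real k * (m - r)" using True r by (simp add: mult_right_mono)
      finally show ?thesis .
    next
      case False
      have "(\<Sum>x\<in>T. p x) \<le> 1"
        using has_sum_mono2[OF has_sum_finite[OF T(1)] p(3) T(2)] p(1) by auto
      then have "(\<Sum>x\<in>T. p x - r) \<le> 1 - real (card T) * r"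
        by (simp add: sum_subtractf)
      also have "\<dots> \<le> 1 - (real k + 1) * r"
        using False r by (simp add: mult_right_mono)
      also have "\<dots> = real k * (m - r)" using r(1) by (simp add: algebra_simps)
      finally show ?thesis .
    qed
    finally show ?thesis .
  qed
  have summ: "(\<lambda>x. max 0 (p x - r)) summable_on A"
    by (rule nonneg_bdd_above_summable_on) (use fin in \<open>auto intro!: bdd_aboveI2\<close>)
  have "((\<lambda>x. a * p x + c * max 0 (p x - r)) has_sum
      a * 1 + c * (\<Sum>\<^sub>\<infinity>x\<in>A. max 0 (p x - r))) A"
    using summ p(3) by (intro has_sum_add has_sum_cmult_right) auto
  from has_sum_mono[OF S this] le p
  have "S \<le> a + c * (\<Sum>\<^sub>\<infinity>x\<in>A. max 0 (p x - r))" by simp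
  also have "\<dots> \<le> a + c * (real k * (m - r))"
    using c0 summ fin by (intro add_left_mono mult_left_mono infsum_le_finite_sums) auto
  also have "\<dots> = real k * f m + f r"
    (is "a + ?C = _")
  proof -
    have "a + ?C = a * (r + real k * m) + ?C" using r(1) by simp
    also have "\<dots> = real k * f m + f r"
      unfolding ar[symmetric] fm by (simp add: algebra_simps)
    finally show ?thesis .
  qed
  finally show ?thesis .
qed

text \<open>
  Minkowski's inequality for the vectors \<open>(x + y, \<dots>, x + y, x)\<close>, \<open>(x, \<dots>, x, x)\<close> and
  \<open>(y, \<dots>, y, 0)\<close>, reversed for \<open>\<alpha> < 1\<close>.
\<close>

lemma minkowski_two_level:
  fixes c \<alpha> x y K :: real
  assumes "0 < \<alpha>" "0 \<le> c * (\<alpha> - 1)" "0 < x" "0 < y" "0 < K"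
  shows "K * (c * (x + y) powr \<alpha>) + c * x powr \<alpha>
    \<le> c * ((K + 1) powr (1 / \<alpha>) * x + K powr (1 / \<alpha>) * y) powr \<alpha>"
proof -
  define s where "s = K powr (1 / \<alpha>)"
  define t where "t = (K + 1) powr (1 / \<alpha>)"
  define T where "T = t * x + s * y"
  have pos: "0 < s" "0 < t" "0 < T" using assms by (auto simp: s_def t_def T_def add_pos_pos)
  have sp: "s powr \<alpha> = K" "t powr \<alpha> = K + 1"
    using assms by (auto simp: s_def t_def powr_powr)
  \<comment> \<open>The usual normalisation: \<open>u\<close> and \<open>v\<close> are the shares of
    the two summands in \<open>T\<close>. The level \<open>T / t\<close> on \<open>K + 1\<close>
    entries and the level \<open>T / s\<close> on \<open>K\<close> entries both give norm
    \<open>T\<close>, and they are mixed with weights \<open>u\<close> and \<open>v\<close>.\<close>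
  define u where "u = t * x / T"
  define v where "v = s * y / T"
  have uv: "0 \<le> u" "0 \<le> v" "u + v = 1"
    using pos assms by (auto simp: u_def v_def T_def add_divide_distrib[symmetric])
  have x: "x = u * (T / t)" and xy: "x + y = u * (T / t) + v * (T / s)"
    using pos by (auto simp: u_def v_def)
  have Tt: "(T / t) powr \<alpha> = T powr \<alpha> / (K + 1)" "(T / s) powr \<alpha> = T powr \<alpha> / K"
    using pos sp by (auto simp: powr_divide)
  have conv: "convex_on {0..} (\<lambda>x. c * x powr \<alpha>)"
    using assms by (intro convex_on_mult_powr_nonneg)
  have *: "c * (u * a + v * b) powr \<alpha> \<le> u * (c * a powr \<alpha>) + v * (c * b powr \<alpha>)"
    if "0 \<le> a" "0 \<le> b" for a b
    using conv uv that unfolding convex_on_def by auto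
  have "c * (x + y) powr \<alpha> \<le> u * (c * (T powr \<alpha> / (K + 1))) + v * (c * (T powr \<alpha> / K))"
    using *[of "T / t" "T / s"] pos unfolding xy Tt by simp
  then have "K * (c * (x + y) powr \<alpha>) \<le>
      K * (u * (c * (T powr \<alpha> / (K + 1))) + v * (c * (T powr \<alpha> / K)))"
    using assms by (intro mult_left_mono) auto
  moreover have "c * x powr \<alpha> \<le> u * (c * (T powr \<alpha> / (K + 1)))"
    using *[of "T / t" 0] pos unfolding Tt x[symmetric] by simp
  ultimately have "K * (c * (x + y) powr \<alpha>) + c * x powr \<alpha> \<le>
      K * (u * (c * (T powr \<alpha> / (K + 1))) + v * (c * (T powr \<alpha> / K)))
      + u * (c * (T powr \<alpha> / (K + 1)))" by simp
  also have "\<dots> = (u + v) * (c * T powr \<alpha>)"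
    using assms by (simp add: divide_simps) (simp add: algebra_simps)
  finally show ?thesis using uv by (simp add: T_def s_def t_def)
qed

text \<open>A negative \<open>c\<close> reverses hypothesis and conclusion alike. This takes roots
  in an inequality whose direction depends on the sign of \<open>\<alpha> - 1\<close>.\<close>

lemma mult_powr_mono:
  fixes c p x y :: real
  assumes "0 \<le> p" "0 \<le> x" "0 \<le> y" "c * x \<le> c * y"
  shows "c * x powr p \<le> c * y powr p"
proof (cases c "0::real" rule: linorder_cases)
  case less
  then show ?thesis using assms by (auto intro!: powr_mono2)
next
  case greater
  then show ?thesis using assms by (auto intro!: powr_mono2)
qed simp

text \<open>
  The right-hand side is the chord of \<open>m \<mapsto> m powr (1 - 1/\<alpha>)\<close> through \<open>1 / (k + 1)\<close> and
  \<open>1 / k\<close>. Outside these two nodes the chord is on the right side of the curve, which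
  bounds the norm for every \<open>m\<close>; only \<open>m\<close> between the nodes needs the sharper extremal bound.
\<close>

lemma powr_norm_chord_bound:
  fixes p :: "'a \<Rightarrow> real" and \<alpha> m :: real and k :: nat
  assumes \<alpha>: "0 < \<alpha>" "\<alpha> \<noteq> 1" and k: "1 \<le> k"
    and p: "\<And>x. x \<in> A \<Longrightarrow> 0 \<le> p x" "\<And>x. x \<in> A \<Longrightarrow> p x \<le> m" "0 < m" "(p has_sum 1) A"
    and S: "((\<lambda>x. p x powr \<alpha>) has_sum S) A"
  shows "sgn (\<alpha> - 1) * S powr (1 / \<alpha>) \<le>
    sgn (\<alpha> - 1) * ((real k + 1) powr (1 / \<alpha>) * (1 - real k * m)
      + real k powr (1 / \<alpha>) * ((real k + 1) * m - 1))"
proof -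
  define c where "c = sgn (\<alpha> - 1)"
  have c1: "0 \<le> c * (\<alpha> - 1)" by (simp add: c_def sgn_if)
  have S0: "0 \<le> S" by (rule has_sum_nonneg[OF S]) simp
  have cS: "((\<lambda>x. c * p x powr \<alpha>) has_sum c * S) A"
    using S by (rule has_sum_cmult_right)
  have conv: "convex_on {0..} (\<lambda>x. c * x powr \<alpha>)"
    using \<alpha> c1 by (intro convex_on_mult_powr_nonneg) auto
  show ?thesis
  proof (cases "m \<le> 1 / (real k + 1) \<or> 1 / real k \<le> m")
    case True
    have "c * S \<le> c * (m powr \<alpha> / m)"
      using has_sum_convex_le[OF conv _ p cS] by simp
    then have "c * S powr (1 / \<alpha>) \<le> c * (m powr \<alpha> / m) powr (1 / \<alpha>)"
      using \<alpha> S0 p by (intro mult_powr_mono) auto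
    also have "m powr \<alpha> / m = m powr (\<alpha> - 1)"
      using p by (simp add: powr_diff)
    also have "\<dots> powr (1 / \<alpha>) = m powr (1 - 1 / \<alpha>)"
      using \<alpha> by (simp add: powr_powr diff_divide_distrib)
    also have "c * m powr (1 - 1 / \<alpha>) \<le> c * ((real k + 1) powr (1 / \<alpha>) * (1 - real k * m)
      + real k powr (1 / \<alpha>) * ((real k + 1) * m - 1))"
    proof -
      \<comment> \<open>The curve \<open>m powr (1 - 1 / \<alpha>)\<close> is concave for
        \<open>\<alpha> > 1\<close> and convex for \<open>\<alpha> < 1\<close>, hence the factor
        \<open>- c\<close>.\<close>
      have "0 \<le> c * (\<alpha> - 1) / (\<alpha> * \<alpha>)" using c1 by simp
      also have "\<dots> = (- c) * ((1 - 1 / \<alpha>) * (1 - 1 / \<alpha> - 1))"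
        using \<alpha> by (simp add: field_simps)
      finally have "convex_on {0<..} (\<lambda>x. (- c) * x powr (1 - 1 / \<alpha>))"
        by (rule convex_on_mult_powr_pos)
      from convex_on_chord_outside[OF this, of "1 / (real k + 1)" "1 / real k" m] True k p(3)
      have "(- c) * (1 / (real k + 1)) powr (1 - 1 / \<alpha>) * (1 / real k - m)
        + (- c) * (1 / real k) powr (1 - 1 / \<alpha>) * (m - 1 / (real k + 1))
        \<le> (- c) * m powr (1 - 1 / \<alpha>) * (1 / real k - 1 / (real k + 1))"
        by (simp add: field_simps)
      moreover have "(1 / K) powr (1 - 1 / \<alpha>) = K powr (1 / \<alpha>) / K" if "0 < K" for K :: real
        using that \<alpha> by (simp add: powr_divide powr_diff)
      moreover have "(1 / real k - m) = (1 - real k * m) / real k"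
        "m - 1 / (real k + 1) = ((real k + 1) * m - 1) / (real k + 1)"
        "1 / real k - 1 / (real k + 1) = 1 / (real k * (real k + 1))"
        using k by (auto simp: divide_simps)
      moreover have "(- c) * (t / (K + 1)) * ((1 - K * m) / K)
          + (- c) * (s / K) * (((K + 1) * m - 1) / (K + 1))
        = ((- c) * (t * (1 - K * m) + s * ((K + 1) * m - 1))) / (K * (K + 1))"
        if "0 < K" for K s t :: real
        using that by (simp add: divide_simps) (simp add: algebra_simps)
      ultimately have "((- c) * ((real k + 1) powr (1 / \<alpha>) * (1 - real k * m)
         + real k powr (1 / \<alpha>) * ((real k + 1) * m - 1))) / (real k * (real k + 1))
        \<le> (- c) * m powr (1 - 1 / \<alpha>) / (real k * (real k + 1))"
        using k by simp
      then show ?thesis using k by (simp add: divide_le_cancel)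
    qed
    finally show ?thesis by (simp add: c_def)
  next
    case False
    \<comment> \<open>The mass left by \<open>k\<close> entries equal to \<open>m\<close>. Lying
      strictly between the nodes means exactly \<open>0 < r < m\<close>.\<close>
    define r where "r = 1 - real k * m"
    have r: "0 < r" "r < m"
      using False k by (auto simp: r_def field_simps)
    have mr: "(real k + 1) * m - 1 = m - r" by (simp add: r_def algebra_simps)
    define T where "T = (real k + 1) powr (1 / \<alpha>) * r + real k powr (1 / \<alpha>) * (m - r)"
    have T: "0 \<le> T" using r by (simp add: T_def)
    have "c * S \<le> real k * (c * m powr \<alpha>) + c * r powr \<alpha>"
      using has_sum_convex_le_extremal[OF conv _ p(1,2,4) r_def r cS] by simp
    also have "\<dots> \<le> c * T powr \<alpha>"
      using minkowski_two_level[OF \<alpha>(1) c1 r(1), of "m - r" "real k"] r k by (simp add: T_def)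
    finally have "c * S powr (1 / \<alpha>) \<le> c * (T powr \<alpha>) powr (1 / \<alpha>)"
      using \<alpha> S0 by (intro mult_powr_mono) auto
    then show ?thesis using \<alpha> T by (simp add: powr_powr mr c_def T_def r_def)
  qed
qed

subsection \<open>Countable sums in the extended nonnegative reals\<close>

text \<open>Enumerating \<open>A\<close> turns the unordered sum into a series, for which
  measurability and interchange with the integral are at hand.\<close>

lemma infsum_ennreal_eq_suminf:
  fixes f :: "'a \<Rightarrow> ennreal"
  assumes "countable A"
  shows "(\<Sum>\<^sub>\<infinity>x\<in>A. f x) = (\<Sum>n. if n \<in> to_nat_on A ` A then f (from_nat_into A n) else 0)"
proof -
  define g where "g n = (if n \<in> to_nat_on A ` A then f (from_nat_into A n) else 0)" for n
  have "(\<Sum>\<^sub>\<infinity>x\<in>A. f x) = (\<Sum>\<^sub>\<infinity>x\<in>A. (g \<circ> to_nat_on A) x)"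
    using assms by (intro infsum_cong) (auto simp: g_def)
  also have "\<dots> = infsum g (to_nat_on A ` A)"
    using assms by (intro infsum_reindex[symmetric] inj_on_to_nat_on)
  also have "\<dots> = infsum g UNIV"
    by (intro infsum_cong_neutral) (auto simp: g_def)
  also have "\<dots> = (\<Sum>n. g n)"
    by (intro sums_unique has_sum_imp_sums has_sum_infsum nonneg_summable_on_complete) simp
  finally show ?thesis by (simp add: g_def)
qed

lemma infsum_single_nonzero:
  fixes f :: "'a \<Rightarrow> 'b::{comm_monoid_add, t2_space}"
  assumes "i \<in> A" "\<And>x. x \<in> A \<Longrightarrow> x \<noteq> i \<Longrightarrow> f x = 0"
  shows "(\<Sum>\<^sub>\<infinity>x\<in>A. f x) = f i"
proof -
  have "infsum f A = infsum f {i}" using assms by (intro infsum_cong_neutral) auto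
  then show ?thesis by simp
qed

lemma borel_measurable_infsum_ennreal:
  fixes f :: "'x \<Rightarrow> 'a \<Rightarrow> ennreal"
  assumes "countable A" and [measurable]: "\<And>x. x \<in> A \<Longrightarrow> f x \<in> borel_measurable M"
  shows "(\<lambda>\<omega>. \<Sum>\<^sub>\<infinity>x\<in>A. f x \<omega>) \<in> borel_measurable M"
  unfolding infsum_ennreal_eq_suminf[OF assms(1)]
proof (rule borel_measurable_suminf_order)
  show "(\<lambda>\<omega>. if n \<in> to_nat_on A ` A then f (from_nat_into A n) \<omega> else 0) \<in> borel_measurable M" for n
    using assms by (cases "n \<in> to_nat_on A ` A") auto
qed

lemma nn_integral_infsum:
  fixes f :: "'x \<Rightarrow> 'a \<Rightarrow> ennreal"
  assumes "countable A" and [measurable]: "\<And>x. x \<in> A \<Longrightarrow> f x \<in> borel_measurable M"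
  shows "(\<integral>\<^sup>+\<omega>. (\<Sum>\<^sub>\<infinity>x\<in>A. f x \<omega>) \<partial>M) = (\<Sum>\<^sub>\<infinity>x\<in>A. \<integral>\<^sup>+\<omega>. f x \<omega> \<partial>M)"
proof -
  have "(\<integral>\<^sup>+\<omega>. (\<Sum>\<^sub>\<infinity>x\<in>A. f x \<omega>) \<partial>M) =
      (\<Sum>n. \<integral>\<^sup>+\<omega>. (if n \<in> to_nat_on A ` A then f (from_nat_into A n) \<omega> else 0) \<partial>M)"
    unfolding infsum_ennreal_eq_suminf[OF assms(1)]
  proof (rule nn_integral_suminf)
    show "(\<lambda>\<omega>. if n \<in> to_nat_on A ` A then f (from_nat_into A n) \<omega> else 0) \<in> borel_measurable M" for n
      using assms by (cases "n \<in> to_nat_on A ` A") auto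
  qed
  also have "\<dots> = (\<Sum>\<^sub>\<infinity>x\<in>A. \<integral>\<^sup>+\<omega>. f x \<omega> \<partial>M)"
    unfolding infsum_ennreal_eq_suminf[OF assms(1)] by (intro suminf_cong) auto
  finally show ?thesis .
qed

lemma infsum_ennreal_eqI:
  fixes f :: "'a \<Rightarrow> real"
  assumes "(f has_sum s) A" "\<And>x. x \<in> A \<Longrightarrow> 0 \<le> f x"
  shows "(\<Sum>\<^sub>\<infinity>x\<in>A. ennreal (f x)) = ennreal s"
proof -
  have "ennreal s = (SUP F\<in>{F. finite F \<and> F \<subseteq> A}. ennreal (sum f F))"
    using infsum_nonneg_is_SUPREMUM_ennreal[of f A] assms
    by (auto simp: infsumI summable_on_def)
  also have "\<dots> = (SUP F\<in>{F. finite F \<and> F \<subseteq> A}. \<Sum>x\<in>F. ennreal (f x))"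
    using assms by (intro SUP_cong) (auto intro!: sum_ennreal[symmetric])
  also have "\<dots> = (\<Sum>\<^sub>\<infinity>x\<in>A. ennreal (f x))"
    by (rule nonneg_infsum_complete[symmetric]) simp
  finally show ?thesis by simp
qed

lemma summable_on_if_infsum_ennreal_finite:
  fixes f :: "'a \<Rightarrow> real"
  assumes "(\<Sum>\<^sub>\<infinity>x\<in>A. ennreal (f x)) \<noteq> \<infinity>" "\<And>x. x \<in> A \<Longrightarrow> 0 \<le> f x"
  shows "f summable_on A"
proof (rule nonneg_bdd_above_summable_on)
  show "bdd_above (sum f ` {F. F \<subseteq> A \<and> finite F})"
  proof (rule bdd_aboveI2)
    fix F assume F: "F \<in> {F. F \<subseteq> A \<and> finite F}"
    then have "ennreal (sum f F) = (\<Sum>x\<in>F. ennreal (f x))"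
      using assms(2) by (intro sum_ennreal[symmetric]) auto
    also have "\<dots> \<le> (\<Sum>\<^sub>\<infinity>x\<in>A. ennreal (f x))"
      using F by (subst nonneg_infsum_complete) (auto intro!: SUP_upper)
    also have "\<dots> = ennreal (enn2real (\<Sum>\<^sub>\<infinity>x\<in>A. ennreal (f x)))"
      using assms(1) by (simp add: top.not_eq_extremum)
    finally show "sum f F \<le> enn2real (\<Sum>\<^sub>\<infinity>x\<in>A. ennreal (f x))"
      by (simp add: ennreal_le_iff)
  qed
qed (use assms in auto)

lemma has_sum_if_infsum_ennreal_eq:
  fixes f :: "'a \<Rightarrow> real"
  assumes "(\<Sum>\<^sub>\<infinity>x\<in>A. ennreal (f x)) = ennreal s" "0 \<le> s" "\<And>x. x \<in> A \<Longrightarrow> 0 \<le> f x"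
  shows "(f has_sum s) A"
proof -
  have "f summable_on A"
    using assms by (intro summable_on_if_infsum_ennreal_finite) auto
  then have *: "(f has_sum infsum f A) A" by (rule has_sum_infsum)
  then have "ennreal (infsum f A) = ennreal s"
    using infsum_ennreal_eqI[OF * assms(3)] assms(1) by simp
  then show ?thesis using * assms by (simp add: infsum_nonneg)
qed

text \<open>Since the sum is finite, only finitely many entries reach a given positive entry; the
  largest of these is a maximum over \<open>A\<close>.\<close>

lemma has_sum_max_attained:
  fixes p :: "'a \<Rightarrow> real"
  assumes "(p has_sum s) A" "0 < s" "\<And>x. x \<in> A \<Longrightarrow> 0 \<le> p x"
  obtains x where "x \<in> A" "0 < p x" "\<And>y. y \<in> A \<Longrightarrow> p y \<le> p x"
proof -
  obtain x0 where x0: "x0 \<in> A" "0 < p x0"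
  proof (rule ccontr)
    assume "\<not> thesis"
    then have "p x = 0" if "x \<in> A" for x
      using assms(3)[OF that] that \<open>\<And>x0. \<lbrakk>x0 \<in> A; 0 < p x0\<rbrakk> \<Longrightarrow> thesis\<close>
      by force
    then have "(p has_sum 0) A" by (rule has_sum_0)
    then show False using assms(1,2) has_sum_unique by fastforce
  qed
  define T where "T = {x \<in> A. p x0 \<le> p x}"
  have "card F \<le> nat \<lfloor>s / p x0\<rfloor>" if F: "F \<subseteq> T" "finite F" for F
  proof -
    have "real (card F) * p x0 \<le> sum p F"
      using F sum_mono[of F "\<lambda>_. p x0" p] by (auto simp: T_def)
    also have "\<dots> \<le> s"
      using has_sum_mono2[OF has_sum_finite[OF F(2)] assms(1)] F assms(3) by (auto simp: T_def)
    finally show ?thesis using x0 by (simp add: le_nat_floor field_simps)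
  qed
  then have fin: "finite T" by (meson finite_if_finite_subsets_card_bdd)
  have "T \<noteq> {}" using x0 by (auto simp: T_def)
  with fin have "Max (p ` T) \<in> p ` T" by (intro Max_in) auto
  then obtain x where x: "x \<in> T" "Max (p ` T) = p x" by auto
  then have max: "p y \<le> p x" if "y \<in> T" for y
    using fin that by (simp flip: x(2))
  show thesis
  proof (rule that)
    show "x \<in> A" "0 < p x" using x(1) x0 by (auto simp: T_def)
    show "p y \<le> p x" if "y \<in> A" for y
      using max[of y] that x(1) by (cases "y \<in> T") (auto simp: T_def)
  qed
qed

subsection \<open>The posterior distribution and the optimal guess\<close>

locale guessing = prob_space M for M :: "'a measure" +
  fixes A :: "'x set" and N :: "'y measure" and X :: "'a \<Rightarrow> 'x" and Y :: "'a \<Rightarrow> 'y"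
  assumes A: "countable A"
    and X[measurable]: "X \<in> M \<rightarrow>\<^sub>M count_space A"
    and Y[measurable]: "Y \<in> M \<rightarrow>\<^sub>M N"
begin

abbreviation "F \<equiv> vimage_algebra (space M) Y N"
abbreviation "cp \<equiv> cond_prob_given M N X Y"

lemma A_nonempty: "A \<noteq> {}"
  using not_empty measurable_space[OF X] by auto

lemma sets_F: "sets F = {Y -` B \<inter> space M | B. B \<in> sets N}"
  using measurable_space[OF Y] by (intro sets_vimage_algebra2) auto

lemma subalgebra_F: "subalgebra M F"
  using measurable_sets[OF Y] by (auto simp: subalgebra_def sets_F)

sublocale finite_measure_subalgebra M F
  by unfold_locales (rule subalgebra_F)

lemma sets_F_M: "B \<in> sets F \<Longrightarrow> B \<in> sets M"
  using subalgebra_F by (auto simp: subalgebra_def)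

lemma measurable_F_M: "f \<in> F \<rightarrow>\<^sub>M K \<Longrightarrow> f \<in> M \<rightarrow>\<^sub>M K"
  by (rule measurable_from_subalg[OF subalgebra_F])

lemma X_eq_sets [measurable]: "{\<omega> \<in> space M. X \<omega> = x} \<in> sets M"
proof (cases "x \<in> A")
  case True
  then have "X -` {x} \<inter> space M \<in> sets M" by (intro measurable_sets[OF X]) auto
  also have "X -` {x} \<inter> space M = {\<omega> \<in> space M. X \<omega> = x}" by auto
  finally show ?thesis .
next
  case False
  then have "{\<omega> \<in> space M. X \<omega> = x} = {}" using measurable_space[OF X] by auto
  then show ?thesis by simp
qed

lemma cp_measurable [measurable]: "cp x \<in> borel_measurable F"
  by (simp add: cond_prob_given_def)

lemma integrable_ind: "integrable M (indicator {\<omega> \<in> space M. X \<omega> = x} :: 'a \<Rightarrow> real)"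
  by (simp add: integrable_indicator_iff emeasure_finite less_top[symmetric])

lemma AE_cp_nonneg: "AE \<omega> in M. 0 \<le> cp x \<omega>"
  unfolding cond_prob_given_def by (rule real_cond_exp_pos) auto

text \<open>The defining property of conditional expectation, moved to the nonnegative integral so
  that it can be summed over \<open>A\<close>.\<close>

lemma nn_integral_cp:
  assumes B: "B \<in> sets F"
  shows "(\<integral>\<^sup>+\<omega>. ennreal (cp x \<omega>) * indicator B \<omega> \<partial>M) = emeasure M {\<omega> \<in> B. X \<omega> = x}"
proof -
  have [measurable]: "B \<in> sets M" using B by (rule sets_F_M)
  have Beq: "{\<omega> \<in> B. X \<omega> = x} = B \<inter> {\<omega> \<in> space M. X \<omega> = x}"
    using sets.sets_into_space[OF \<open>B \<in> sets M\<close>] by auto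
  have int: "integrable M (\<lambda>\<omega>. indicator B \<omega> * cp x \<omega>)"
    using integrable_mult_indicator[OF \<open>B \<in> sets M\<close>, of "cp x"] real_cond_exp_int(1)[OF integrable_ind]
    by (simp add: cond_prob_given_def)
  have "(\<integral>\<^sup>+\<omega>. ennreal (cp x \<omega>) * indicator B \<omega> \<partial>M) = (\<integral>\<^sup>+\<omega>. ennreal (indicator B \<omega> * cp x \<omega>) \<partial>M)"
    by (intro nn_integral_cong) (auto split: split_indicator)
  also have "\<dots> = ennreal (\<integral>\<omega>. indicator B \<omega> * cp x \<omega> \<partial>M)"
    using AE_cp_nonneg[of x] by (intro nn_integral_eq_integral int) (auto split: split_indicator)
  also have "(\<integral>\<omega>. indicator B \<omega> * cp x \<omega> \<partial>M) = (\<integral>\<omega>\<in>B. cp x \<omega> \<partial>M)"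
    by (simp add: set_lebesgue_integral_def)
  also have "\<dots> = (\<integral>\<omega>\<in>B. indicator {\<omega> \<in> space M. X \<omega> = x} \<omega> \<partial>M)"
    unfolding cond_prob_given_def by (rule real_cond_exp_intA[symmetric, OF integrable_ind B])
  also have "\<dots> = (\<integral>\<omega>. indicator {\<omega> \<in> B. X \<omega> = x} \<omega> \<partial>M)"
    unfolding set_lebesgue_integral_def Beq
    by (intro Bochner_Integration.integral_cong) (auto split: split_indicator)
  also have "\<dots> = measure M {\<omega> \<in> B. X \<omega> = x}"
    unfolding Beq by simp
  finally show ?thesis by (simp add: emeasure_eq_measure)
qed

lemma infsum_emeasure_X:
  assumes B: "B \<in> sets M"
  shows "(\<Sum>\<^sub>\<infinity>x\<in>A. emeasure M {\<omega> \<in> B. X \<omega> = x}) = emeasure M B"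
proof -
  have sp: "B \<subseteq> space M" using B by (rule sets.sets_into_space)
  have *: "{\<omega> \<in> B. X \<omega> = x} = B \<inter> {\<omega> \<in> space M. X \<omega> = x}" for x using sp by auto
  have "(\<Sum>\<^sub>\<infinity>x\<in>A. emeasure M {\<omega> \<in> B. X \<omega> = x}) =
      (\<Sum>\<^sub>\<infinity>x\<in>A. \<integral>\<^sup>+\<omega>. indicator {\<omega> \<in> B. X \<omega> = x} \<omega> \<partial>M)"
    unfolding * using B by (intro infsum_cong) simp
  also have "\<dots> = (\<integral>\<^sup>+\<omega>. (\<Sum>\<^sub>\<infinity>x\<in>A. indicator {\<omega> \<in> B. X \<omega> = x} \<omega>) \<partial>M)"
    unfolding * using B A by (intro nn_integral_infsum[symmetric]) auto
  also have "\<dots> = (\<integral>\<^sup>+\<omega>. indicator B \<omega> \<partial>M)"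
  proof (intro nn_integral_cong)
    fix \<omega> assume "\<omega> \<in> space M"
    then have "X \<omega> \<in> A" using measurable_space[OF X] by auto
    then show "(\<Sum>\<^sub>\<infinity>x\<in>A. indicator {\<omega> \<in> B. X \<omega> = x} \<omega>) = (indicator B \<omega> :: ennreal)"
      by (subst infsum_single_nonzero[of "X \<omega>"]) (auto split: split_indicator)
  qed
  finally show ?thesis using B by simp
qed

text \<open>Over every \<open>B\<close> in \<open>F\<close> the sum has integral
  \<open>emeasure M B\<close>, as the constant \<open>1\<close> does. Both are
  \<open>F\<close>-measurable, so both are versions of the same conditional expectation.\<close>

lemma AE_cp_sum: "AE \<omega> in M. (\<Sum>\<^sub>\<infinity>x\<in>A. ennreal (cp x \<omega>)) = 1"
proof -
  have meas: "(\<lambda>\<omega>. \<Sum>\<^sub>\<infinity>x\<in>A. ennreal (cp x \<omega>)) \<in> borel_measurable F"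
    using A by (intro borel_measurable_infsum_ennreal) auto
  have eq: "(\<integral>\<^sup>+\<omega>\<in>B. 1 \<partial>M) = (\<integral>\<^sup>+\<omega>\<in>B. (\<Sum>\<^sub>\<infinity>x\<in>A. ennreal (cp x \<omega>)) \<partial>M)" if B: "B \<in> sets F" for B
  proof -
    have [measurable]: "B \<in> sets M" "\<And>x. cp x \<in> borel_measurable M"
      using B by (auto intro: sets_F_M measurable_F_M)
    have "(\<integral>\<^sup>+\<omega>\<in>B. (\<Sum>\<^sub>\<infinity>x\<in>A. ennreal (cp x \<omega>)) \<partial>M) =
        (\<integral>\<^sup>+\<omega>. (\<Sum>\<^sub>\<infinity>x\<in>A. ennreal (cp x \<omega>) * indicator B \<omega>) \<partial>M)"
      by (intro nn_integral_cong) (auto split: split_indicator)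
    also have "\<dots> = (\<Sum>\<^sub>\<infinity>x\<in>A. \<integral>\<^sup>+\<omega>. ennreal (cp x \<omega>) * indicator B \<omega> \<partial>M)"
      using A by (intro nn_integral_infsum) auto
    also have "\<dots> = emeasure M B"
      unfolding nn_integral_cp[OF B] by (rule infsum_emeasure_X) simp
    finally show ?thesis by simp
  qed
  have "AE \<omega> in M. (\<Sum>\<^sub>\<infinity>x\<in>A. ennreal (cp x \<omega>)) = nn_cond_exp M F (\<lambda>_. 1) \<omega>"
    by (rule nn_cond_exp_charact[OF eq _ meas]) auto
  moreover have "AE \<omega> in M. 1 = nn_cond_exp M F (\<lambda>_. 1) \<omega>"
    by (rule nn_cond_exp_F_meas) auto
  ultimately show ?thesis by eventually_elim simp
qed

definition regular :: "'a \<Rightarrow> bool" where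
  "regular \<omega> \<longleftrightarrow> (\<forall>x\<in>A. 0 \<le> cp x \<omega>) \<and> (\<Sum>\<^sub>\<infinity>x\<in>A. ennreal (cp x \<omega>)) = 1"

text \<open>
  A version of the conditional probabilities that is a probability vector at every point,
  not only almost surely.
\<close>

definition post :: "'x \<Rightarrow> 'a \<Rightarrow> real" where
  "post x \<omega> = (if regular \<omega> then cp x \<omega> else indicator {SOME x. x \<in> A} x)"

lemma regular_measurable [measurable]: "Measurable.pred F regular"
proof -
  have [measurable]: "(\<lambda>\<omega>. \<Sum>\<^sub>\<infinity>x\<in>A. ennreal (cp x \<omega>)) \<in> borel_measurable F"
    using A by (intro borel_measurable_infsum_ennreal) auto
  have "Measurable.pred F (\<lambda>\<omega>. \<forall>x\<in>A. 0 \<le> cp x \<omega>)"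
    using A by (intro measurable_pred_countable) auto
  then show ?thesis unfolding regular_def[abs_def] by measurable
qed

lemma post_measurable_F [measurable]: "post x \<in> borel_measurable F"
  unfolding post_def[abs_def] by measurable

lemma post_measurable [measurable]: "post x \<in> borel_measurable M"
  by (rule measurable_F_M) measurable

lemma AE_regular: "AE \<omega> in M. regular \<omega>"
proof -
  have "AE \<omega> in M. \<forall>x\<in>A. 0 \<le> cp x \<omega>"
    using A AE_cp_nonneg by (intro AE_ball_countable') auto
  with AE_cp_sum show ?thesis unfolding regular_def by eventually_elim simp
qed

lemma AE_post_eq: "AE \<omega> in M. \<forall>x. post x \<omega> = cp x \<omega>"
  using AE_regular by eventually_elim (simp add: post_def)

lemma post_nonneg: "x \<in> A \<Longrightarrow> 0 \<le> post x \<omega>"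
  by (simp add: post_def regular_def)

lemma post_has_sum: "((\<lambda>x. post x \<omega>) has_sum 1) A"
proof (cases "regular \<omega>")
  case True
  then have "((\<lambda>x. cp x \<omega>) has_sum 1) A"
    by (intro has_sum_if_infsum_ennreal_eq) (auto simp: regular_def)
  then show ?thesis using True by (simp add: post_def)
next
  case False
  \<comment> \<open>At points that are not regular, \<open>post\<close> is the point mass at a fixed
    element of \<open>A\<close>.\<close>
  define x0 where "x0 = (SOME x. x \<in> A)"
  have "x0 \<in> A" using A_nonempty by (auto simp: x0_def intro: someI)
  have "((indicator {x0} :: 'x \<Rightarrow> real) has_sum 1) {x0}"
    using has_sum_finite[of "{x0}" "indicator {x0} :: 'x \<Rightarrow> real"] by simp
  then have "((indicator {x0} :: 'x \<Rightarrow> real) has_sum 1) A"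
    using \<open>x0 \<in> A\<close> by (subst has_sum_cong_neutral[where S = A and T = "{x0}" and g = "indicator {x0}"]) auto
  then show ?thesis using False by (simp add: post_def x0_def)
qed

text \<open>As a supremum over a countable set it is measurable at once; that it is attained is
  shown separately.\<close>

definition pmax :: "'a \<Rightarrow> real" where "pmax \<omega> = (SUP x\<in>A. post x \<omega>)"

lemma pmax_attained: obtains x where "x \<in> A" "post x \<omega> = pmax \<omega>" "0 < pmax \<omega>"
proof -
  obtain x where x: "x \<in> A" "0 < post x \<omega>" "\<And>y. y \<in> A \<Longrightarrow> post y \<omega> \<le> post x \<omega>"
    using has_sum_max_attained[OF post_has_sum[of \<omega>]] post_nonneg by auto
  have "pmax \<omega> = post x \<omega>"
    unfolding pmax_def using x by (intro cSup_eq_maximum) auto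
  then show thesis using x that by metis
qed

lemma post_le_1: "x \<in> A \<Longrightarrow> post x \<omega> \<le> 1"
  using has_sum_mono2[OF has_sum_finite[of "{x}"] post_has_sum] post_nonneg by auto

lemma post_le_pmax: "x \<in> A \<Longrightarrow> post x \<omega> \<le> pmax \<omega>"
  unfolding pmax_def by (rule cSUP_upper) (auto intro!: bdd_aboveI2 post_le_1)

lemma pmax_pos: "0 < pmax \<omega>" and pmax_le_1: "pmax \<omega> \<le> 1"
  by (metis pmax_attained, metis pmax_attained post_le_1)

lemma pmax_measurable_F [measurable]: "pmax \<in> borel_measurable F"
  unfolding pmax_def[abs_def]
  by (intro borel_measurable_cSUP A) (auto intro!: bdd_aboveI2 post_le_1)

lemma pmax_measurable [measurable]: "pmax \<in> borel_measurable M"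
  by (rule measurable_F_M) measurable

lemma integrable_pmax: "integrable M pmax"
  by (rule integrable_const_bound[where B = 1])
    (auto simp: abs_le_iff pmax_le_1 intro!: AE_I2 order_trans[OF _ less_imp_le[OF pmax_pos]])

section \<open>Error probability of an estimator and the optimal estimator\<close>

lemma nn_integral_post:
  assumes B: "B \<in> sets F"
  shows "(\<integral>\<^sup>+\<omega>. ennreal (post x \<omega>) * indicator B \<omega> \<partial>M) = emeasure M {\<omega> \<in> B. X \<omega> = x}"
  unfolding nn_integral_cp[OF B, symmetric]
  by (rule nn_integral_cong_AE, use AE_post_eq in eventually_elim) simp

text \<open>The events \<open>L (Y \<omega>) = x\<close> lie in \<open>F\<close>, and on each the
  probability of \<open>X = x\<close> is the integral of \<open>post x\<close>. Summing over
  \<open>x\<close> gives the probability of a correct guess.\<close>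

lemma prob_error_eq:
  assumes L: "L \<in> N \<rightarrow>\<^sub>M count_space A"
  shows "integrable M (\<lambda>\<omega>. post (L (Y \<omega>)) \<omega>)"
    and "measure M {\<omega> \<in> space M. X \<omega> \<noteq> L (Y \<omega>)} = 1 - (\<integral>\<omega>. post (L (Y \<omega>)) \<omega> \<partial>M)"
proof -
  note [measurable] = L
  have LY [measurable]: "(\<lambda>\<omega>. L (Y \<omega>)) \<in> M \<rightarrow>\<^sub>M count_space A" by measurable
  have LA: "L (Y \<omega>) \<in> A" if "\<omega> \<in> space M" for \<omega>
    using measurable_space[OF LY that] by simp
  have meas [measurable]: "(\<lambda>\<omega>. post (L (Y \<omega>)) \<omega>) \<in> borel_measurable M"
    by (rule measurable_compose_countable'[OF _ LY A]) auto
  show int: "integrable M (\<lambda>\<omega>. post (L (Y \<omega>)) \<omega>)"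
    by (rule integrable_const_bound[where B = 1])
      (auto simp: abs_le_iff intro!: AE_I2 post_le_1 LA order_trans[OF _ post_nonneg])
  define B where "B x = {\<omega> \<in> space M. L (Y \<omega>) = x}" for x
  have B: "B x \<in> sets F" if "x \<in> A" for x
  proof -
    have "L -` {x} \<inter> space N \<in> sets N" using that by (intro measurable_sets[OF L]) auto
    moreover have "B x = Y -` (L -` {x} \<inter> space N) \<inter> space M"
      using measurable_space[OF Y] by (auto simp: B_def)
    ultimately show ?thesis unfolding sets_F by blast
  qed
  have [measurable]: "B x \<in> sets M" if "x \<in> A" for x using B that sets_F_M by blast
  have E [measurable]: "{\<omega> \<in> space M. X \<omega> = L (Y \<omega>)} \<in> sets M"
  proof -
    have "{\<omega> \<in> space M. X \<omega> = L (Y \<omega>)} = (\<Union>x\<in>A. B x \<inter> {\<omega> \<in> space M. X \<omega> = x})"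
      using LA by (auto simp: B_def)
    also have "\<dots> \<in> sets M" using A by (intro sets.countable_UN') auto
    finally show ?thesis .
  qed
  have "ennreal (\<integral>\<omega>. post (L (Y \<omega>)) \<omega> \<partial>M) = (\<integral>\<^sup>+\<omega>. ennreal (post (L (Y \<omega>)) \<omega>) \<partial>M)"
    by (intro nn_integral_eq_integral[symmetric] int AE_I2 post_nonneg LA)
  also have "\<dots> = (\<integral>\<^sup>+\<omega>. (\<Sum>\<^sub>\<infinity>x\<in>A. ennreal (post x \<omega>) * indicator (B x) \<omega>) \<partial>M)"
  proof (intro nn_integral_cong)
    fix \<omega> assume w: "\<omega> \<in> space M"
    show "ennreal (post (L (Y \<omega>)) \<omega>) = (\<Sum>\<^sub>\<infinity>x\<in>A. ennreal (post x \<omega>) * indicator (B x) \<omega>)"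
      by (subst infsum_single_nonzero[of "L (Y \<omega>)"]) (use w LA in \<open>auto simp: B_def\<close>)
  qed
  also have "\<dots> = (\<Sum>\<^sub>\<infinity>x\<in>A. \<integral>\<^sup>+\<omega>. ennreal (post x \<omega>) * indicator (B x) \<omega> \<partial>M)"
    using A by (intro nn_integral_infsum) auto
  also have "\<dots> = (\<Sum>\<^sub>\<infinity>x\<in>A. emeasure M {\<omega> \<in> {\<omega> \<in> space M. X \<omega> = L (Y \<omega>)}. X \<omega> = x})"
  proof (intro infsum_cong)
    fix x assume "x \<in> A"
    have "{\<omega> \<in> B x. X \<omega> = x} = {\<omega> \<in> {\<omega> \<in> space M. X \<omega> = L (Y \<omega>)}. X \<omega> = x}"
      by (auto simp: B_def)
    then show "(\<integral>\<^sup>+\<omega>. ennreal (post x \<omega>) * indicator (B x) \<omega> \<partial>M) =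
        emeasure M {\<omega> \<in> {\<omega> \<in> space M. X \<omega> = L (Y \<omega>)}. X \<omega> = x}"
      using nn_integral_post[OF B[OF \<open>x \<in> A\<close>], of x] by simp
  qed
  also have "\<dots> = emeasure M {\<omega> \<in> space M. X \<omega> = L (Y \<omega>)}"
    by (rule infsum_emeasure_X[OF E])
  finally have "(\<integral>\<omega>. post (L (Y \<omega>)) \<omega> \<partial>M) = prob {\<omega> \<in> space M. X \<omega> = L (Y \<omega>)}"
    by (simp add: emeasure_eq_measure integral_nonneg_AE AE_I2 post_nonneg LA)
  moreover have "{\<omega> \<in> space M. X \<omega> \<noteq> L (Y \<omega>)} = space M - {\<omega> \<in> space M. X \<omega> = L (Y \<omega>)}"
    by auto
  ultimately show "prob {\<omega> \<in> space M. X \<omega> \<noteq> L (Y \<omega>)} = 1 - (\<integral>\<omega>. post (L (Y \<omega>)) \<omega> \<partial>M)"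
    using prob_compl[OF E] by simp
qed

text \<open>Pointwise no guess beats \<open>pmax\<close>. For equality a maximiser has to be chosen
  as a measurable function of the observation, not of the sample point.\<close>

lemma min_error_prob_eq: "min_error_prob M A N X Y = 1 - (\<integral>\<omega>. pmax \<omega> \<partial>M)"
proof -
  \<comment> \<open>Optimality of \<open>x\<close> is an event of \<open>F\<close>, so it can be
    read off from \<open>Y\<close>: \<open>B x\<close> is a set of observations at which
    \<open>x\<close> is an optimal guess.\<close>
  have "\<forall>x\<in>A. \<exists>B\<in>sets N. {\<omega> \<in> space F. post x \<omega> = pmax \<omega>} = Y -` B \<inter> space M"
  proof
    fix x assume "x \<in> A"
    have "{\<omega> \<in> space F. post x \<omega> = pmax \<omega>} \<in> sets F" by measurable
    then show "\<exists>B\<in>sets N. {\<omega> \<in> space F. post x \<omega> = pmax \<omega>} = Y -` B \<inter> space M"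
      unfolding sets_F by auto
  qed
  then obtain B where B: "\<And>x. x \<in> A \<Longrightarrow> B x \<in> sets N"
    "\<And>x. x \<in> A \<Longrightarrow> {\<omega> \<in> space F. post x \<omega> = pmax \<omega>} = Y -` B x \<inter> space M"
    by metis
  define e where "e = from_nat_into A"
  have eA: "e n \<in> A" for n using A_nonempty by (simp add: e_def from_nat_into)
  have [measurable]: "B (e n) \<in> sets N" for n using B(1) eA by auto
  \<comment> \<open>The first optimal value along the enumeration. If no \<open>B (e n)\<close>
    contains \<open>y\<close>, the value is still in \<open>A\<close> by \<open>eA\<close>.\<close>
  define L where "L y = e (LEAST n. y \<in> B (e n))" for y
  have L: "L \<in> N \<rightarrow>\<^sub>M count_space A"
    unfolding L_def
  proof (rule measurable_compose[where g = e])
    show "(\<lambda>y. LEAST n. y \<in> B (e n)) \<in> N \<rightarrow>\<^sub>M count_space UNIV" by measurable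
    show "e \<in> count_space UNIV \<rightarrow>\<^sub>M count_space A" using eA by auto
  qed
  have opt: "post (L (Y \<omega>)) \<omega> = pmax \<omega>" if w: "\<omega> \<in> space M" for \<omega>
  proof -
    obtain x where x: "x \<in> A" "post x \<omega> = pmax \<omega>" by (rule pmax_attained)
    then have "Y \<omega> \<in> B x" using B(2)[OF x(1)] w by auto
    moreover obtain n where "e n = x" using x(1) A unfolding e_def by (metis from_nat_into_to_nat_on)
    ultimately have "Y \<omega> \<in> B (L (Y \<omega>))"
      unfolding L_def by (metis (mono_tags, lifting) LeastI)
    then show ?thesis using B(2)[of "L (Y \<omega>)"] eA w by (auto simp: L_def)
  qed
  show ?thesis unfolding min_error_prob_def
  proof (rule cInf_eq_minimum)
    have "(\<integral>\<omega>. post (L (Y \<omega>)) \<omega> \<partial>M) = (\<integral>\<omega>. pmax \<omega> \<partial>M)"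
      by (intro Bochner_Integration.integral_cong) (auto simp: opt)
    then show "1 - (\<integral>\<omega>. pmax \<omega> \<partial>M) \<in>
        (\<lambda>L. prob {\<omega> \<in> space M. X \<omega> \<noteq> L (Y \<omega>)}) ` (N \<rightarrow>\<^sub>M count_space A)"
      using prob_error_eq(2)[OF L] L by (intro image_eqI[of _ _ L]) auto
  next
    fix z assume "z \<in> (\<lambda>L. prob {\<omega> \<in> space M. X \<omega> \<noteq> L (Y \<omega>)}) ` (N \<rightarrow>\<^sub>M count_space A)"
    then obtain L where z: "z = prob {\<omega> \<in> space M. X \<omega> \<noteq> L (Y \<omega>)}"
      and L: "L \<in> N \<rightarrow>\<^sub>M count_space A" by (rule imageE)
    have "(\<integral>\<omega>. post (L (Y \<omega>)) \<omega> \<partial>M) \<le> (\<integral>\<omega>. pmax \<omega> \<partial>M)"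
      using measurable_space[OF L] measurable_space[OF Y]
      by (intro integral_mono prob_error_eq(1)[OF L] integrable_pmax post_le_pmax) auto
    then show "1 - (\<integral>\<omega>. pmax \<omega> \<partial>M) \<le> z"
      unfolding z prob_error_eq(2)[OF L] by simp
  qed
qed

end

subsection \<open>The chord and the error bound\<close>

text \<open>In \<open>m\<close> this is the affine interpolant of
  \<open>m powr (1 - 1 / \<alpha>)\<close> at \<open>1 / k\<close> and
  \<open>1 / (k + 1)\<close>.\<close>

definition chord :: "real \<Rightarrow> nat \<Rightarrow> real \<Rightarrow> real" where
  "chord \<alpha> k m = (real k + 1) powr (1 / \<alpha>) * (1 - real k * m)
      + real k powr (1 / \<alpha>) * ((real k + 1) * m - 1)"

text \<open>Minus the coefficient of \<open>m\<close> in \<open>chord\<close>, and the denominator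
  of \<open>entropy_error_bound\<close>.\<close>

definition chord_slope :: "real \<Rightarrow> nat \<Rightarrow> real" where
  "chord_slope \<alpha> k = real k * (real k + 1) powr (1 / \<alpha>) - real k powr (1 / \<alpha>) * (real k + 1)"

text \<open>After \<open>k * (k + 1)\<close> is factored out, the increment of
  \<open>x powr (1 / \<alpha> - 1)\<close> from \<open>k\<close> to \<open>k + 1\<close> remains;
  the sign of the exponent decides its direction.\<close>

lemma chord_slope_sign:
  assumes "0 < \<alpha>" "\<alpha> \<noteq> 1" "1 \<le> k"
  shows "sgn (chord_slope \<alpha> k) = - sgn (\<alpha> - 1)"
proof -
  have eq: "chord_slope \<alpha> k =
      real k * (real k + 1) * ((real k + 1) powr (1 / \<alpha> - 1) - real k powr (1 / \<alpha> - 1))"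
  proof -
    have "c powr (1 / \<alpha>) = c * c powr (1 / \<alpha> - 1)" if "0 < c" for c :: real
      using that by (simp add: powr_diff)
    from this[of "real k"] this[of "real k + 1"] assms show ?thesis
      unfolding chord_slope_def by (simp add: algebra_simps)
  qed
  have "sgn (chord_slope \<alpha> k) = sgn ((real k + 1) powr (1 / \<alpha> - 1) - real k powr (1 / \<alpha> - 1))"
    unfolding eq using assms by (simp add: sgn_mult)
  also have "\<dots> = - sgn (\<alpha> - 1)"
  proof (cases "1 < \<alpha>")
    case True
    then have "(real k + 1) powr (1 / \<alpha> - 1) < real k powr (1 / \<alpha> - 1)"
      using assms by (intro powr_less_mono2_neg) (auto simp: field_simps)
    then show ?thesis using True by simp
  next
    case False
    then have "real k powr (1 / \<alpha> - 1) < (real k + 1) powr (1 / \<alpha> - 1)"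
      using assms by (intro powr_less_mono2) (auto simp: field_simps)
    then show ?thesis using False assms by simp
  qed
  finally show ?thesis .
qed

text \<open>The bound is the solution \<open>1 - m\<close> of the equation between the exponential
  and \<open>chord \<alpha> k m\<close>. With \<open>m\<close> the expected maximum, the quotient is
  the gap between bound and error probability.\<close>

lemma entropy_error_bound_eq:
  assumes "chord_slope \<alpha> k \<noteq> 0" "1 \<le> k"
  shows "entropy_error_bound b \<alpha> k h =
    1 - m + (b powr ((1 - \<alpha>) / \<alpha> * h) - chord \<alpha> k m) / chord_slope \<alpha> k"
proof -
  have "real k powr (1 / \<alpha> + 1) = real k * real k powr (1 / \<alpha>)"
    using assms by (simp add: powr_add)
  then have "b powr ((1 - \<alpha>) / \<alpha> * h) - real k powr (1 / \<alpha> + 1)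
      + (real k - 1) * (real k + 1) powr (1 / \<alpha>) =
      (1 - m) * chord_slope \<alpha> k + (b powr ((1 - \<alpha>) / \<alpha> * h) - chord \<alpha> k m)"
    by (simp add: chord_def chord_slope_def algebra_simps)
  then show ?thesis
    using assms unfolding entropy_error_bound_def chord_slope_def[symmetric]
    by (simp only: add_divide_distrib) simp
qed

lemma powr_inverse_tendsto_1:
  fixes c :: real
  assumes "0 < c"
  shows "((\<lambda>\<alpha>. c powr (1 / \<alpha>)) \<longlongrightarrow> 1) at_top"
proof -
  have "((\<lambda>\<alpha>::real. 1 / \<alpha>) \<longlongrightarrow> 0) at_top"
    by (simp add: divide_inverse tendsto_inverse_0_at_top filterlim_ident)
  then have "((\<lambda>\<alpha>. c powr (1 / \<alpha>)) \<longlongrightarrow> c powr 0) at_top"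
    using assms by (intro tendsto_powr tendsto_const) auto
  then show ?thesis using assms by simp
qed

text \<open>All powers tend to \<open>1\<close>, which leaves
  \<open>(1 - k * m) + ((k + 1) * m - 1)\<close> and \<open>k - (k + 1)\<close>.\<close>

lemma
  assumes "1 \<le> k"
  shows chord_tendsto: "((\<lambda>\<alpha>. chord \<alpha> k m) \<longlongrightarrow> m) at_top"
    and chord_slope_tendsto: "((\<lambda>\<alpha>. chord_slope \<alpha> k) \<longlongrightarrow> - 1) at_top"
proof -
  note lim = powr_inverse_tendsto_1[of "real k + 1"] powr_inverse_tendsto_1[of "real k"]
  have "((\<lambda>\<alpha>. chord \<alpha> k m) \<longlongrightarrow> 1 * (1 - real k * m) + 1 * ((real k + 1) * m - 1)) at_top"
    unfolding chord_def using assms by (intro tendsto_intros lim) auto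
  then show "((\<lambda>\<alpha>. chord \<alpha> k m) \<longlongrightarrow> m) at_top" by (simp add: algebra_simps)
  have "((\<lambda>\<alpha>. chord_slope \<alpha> k) \<longlongrightarrow> real k * 1 - 1 * (real k + 1)) at_top"
    unfolding chord_slope_def using assms by (intro tendsto_intros lim) auto
  then show "((\<lambda>\<alpha>. chord_slope \<alpha> k) \<longlongrightarrow> - 1) at_top" by simp
qed

text \<open>The first equation recovers the expected norm from the entropy; the second gives the
  exponential of the entropy, which determines \<open>k\<close>.\<close>

lemma powr_scaled_log:
  fixes \<alpha> b x :: real
  assumes "1 < b" "0 < x" "0 < \<alpha>" "\<alpha> \<noteq> 1"
  shows "b powr ((1 - \<alpha>) / \<alpha> * (\<alpha> / (1 - \<alpha>) * log b x)) = x"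
    and "b powr (\<alpha> / (1 - \<alpha>) * log b x) = x powr (\<alpha> / (1 - \<alpha>))"
proof -
  have "(1 - \<alpha>) / \<alpha> * (\<alpha> / (1 - \<alpha>) * log b x) = log b x"
    using assms by simp
  then show "b powr ((1 - \<alpha>) / \<alpha> * (\<alpha> / (1 - \<alpha>) * log b x)) = x"
    using assms by (simp only:) simp
  have "b powr (\<alpha> / (1 - \<alpha>) * log b x) = (b powr log b x) powr (\<alpha> / (1 - \<alpha>))"
    by (simp add: powr_powr mult.commute)
  then show "b powr (\<alpha> / (1 - \<alpha>) * log b x) = x powr (\<alpha> / (1 - \<alpha>))"
    using assms by simp
qed

text \<open>Finiteness excludes \<open>0\<close> and \<open>\<infinity>\<close>, where
  \<open>ennreal_log\<close> is infinite.\<close>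

lemma finite_scaled_ennreal_logE:
  assumes "\<bar>ereal c * ennreal_log b x\<bar> \<noteq> \<infinity>" "c \<noteq> 0"
  obtains r where "0 < r" "x = ennreal r" "ereal c * ennreal_log b x = ereal (c * log b r)"
proof (cases x)
  case (real r)
  then have "0 < r" using assms by (cases "r = 0") (auto simp: ennreal_log_def split: if_splits)
  then show thesis using real that[of r] by (simp add: ennreal_log_def)
next
  case top
  then show thesis using assms by (simp add: ennreal_log_def split: if_splits)
qed

text \<open>A neighbourhood of \<open>l\<close> eventually contains all of the finitely many values
  \<open>f k x\<close> at once, so the index may vary with \<open>x\<close>.\<close>

lemma tendsto_finite_choice:
  assumes "\<And>k. k \<in> K \<Longrightarrow> (f k \<longlongrightarrow> l) F" "finite K" "eventually (\<lambda>x. \<kappa> x \<in> K) F"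
  shows "((\<lambda>x. f (\<kappa> x) x) \<longlongrightarrow> l) F"
proof (rule topological_tendstoI)
  fix S assume "open S" "l \<in> S"
  then have "eventually (\<lambda>x. \<forall>k\<in>K. f k x \<in> S) F"
    using assms(1,2) by (intro eventually_ball_finite) (auto dest: topological_tendstoD)
  with assms(3) show "eventually (\<lambda>x. f (\<kappa> x) x \<in> S) F"
    by eventually_elim auto
qed

text \<open>Negative values lower the left side, while \<open>ennreal\<close> cuts them off on the
  right. This is meant for the chord, which can be negative when
  \<open>\<alpha> < 1\<close>.\<close>

lemma ennreal_integral_le_nn_integral:
  assumes "integrable M f"
  shows "ennreal (\<integral>x. f x \<partial>M) \<le> (\<integral>\<^sup>+x. ennreal (f x) \<partial>M)"
proof -
  have int: "integrable M (\<lambda>x. max 0 (f x))" using assms by auto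
  have "ennreal (\<integral>x. f x \<partial>M) \<le> ennreal (\<integral>x. max 0 (f x) \<partial>M)"
    by (intro ennreal_leI integral_mono assms int) auto
  also have "\<dots> = (\<integral>\<^sup>+x. ennreal (max 0 (f x)) \<partial>M)"
    by (rule nn_integral_eq_integral[symmetric, OF int]) auto
  also have "\<dots> = (\<integral>\<^sup>+x. ennreal (f x) \<partial>M)"
    by (intro nn_integral_cong) (auto simp: max_def ennreal_neg)
  finally show ?thesis .
qed

section \<open>The expected norm of the posterior, the error bound and its limit\<close>

context guessing
begin

definition post_norm :: "real \<Rightarrow> 'a \<Rightarrow> ennreal" where
  "post_norm \<alpha> \<omega> = ennreal_powr (\<Sum>\<^sub>\<infinity>x\<in>A. ennreal (post x \<omega> powr \<alpha>)) (1 / \<alpha>)"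

lemma arimoto_renyi_cond_entropy_eq:
  "arimoto_renyi_cond_entropy b M A N \<alpha> X Y =
    ereal (\<alpha> / (1 - \<alpha>)) * ennreal_log b (\<integral>\<^sup>+\<omega>. post_norm \<alpha> \<omega> \<partial>M)"
proof -
  have "(\<integral>\<^sup>+\<omega>. ennreal_powr (\<Sum>\<^sub>\<infinity>x\<in>A. ennreal (cp x \<omega> powr \<alpha>)) (1 / \<alpha>) \<partial>M)
      = (\<integral>\<^sup>+\<omega>. post_norm \<alpha> \<omega> \<partial>M)"
    by (rule nn_integral_cong_AE, use AE_post_eq in eventually_elim) (simp add: post_norm_def)
  then show ?thesis by (simp add: arimoto_renyi_cond_entropy_def)
qed

lemma post_norm_eq:
  assumes "((\<lambda>x. post x \<omega> powr \<alpha>) has_sum S) A"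
  shows "post_norm \<alpha> \<omega> = ennreal (S powr (1 / \<alpha>))"
proof -
  have "0 \<le> S" using assms by (rule has_sum_nonneg) simp
  then show ?thesis using infsum_ennreal_eqI[OF assms] by (simp add: post_norm_def ennreal_powr_def)
qed

lemma chord_bound_post:
  assumes "0 < \<alpha>" "\<alpha> \<noteq> 1" "1 \<le> k" "((\<lambda>x. post x \<omega> powr \<alpha>) has_sum S) A"
  shows "sgn (\<alpha> - 1) * S powr (1 / \<alpha>) \<le> sgn (\<alpha> - 1) * chord \<alpha> k (pmax \<omega>)"
  unfolding chord_def
  by (rule powr_norm_chord_bound[OF assms(1-3) post_nonneg post_le_pmax pmax_pos post_has_sum assms(4)])

text \<open>Entries lie in \<open>[0, 1]\<close>, so raising them to the power
  \<open>\<alpha>\<close> decreases them: the sum converges and the norm is at most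
  \<open>1\<close>. The largest term alone gives the lower bound. The chord is nonnegative because
  it lies above the norm.\<close>

lemma post_norm_gt1:
  assumes "1 < \<alpha>"
  shows "ennreal (pmax \<omega>) \<le> post_norm \<alpha> \<omega>" "post_norm \<alpha> \<omega> \<le> 1"
    and "1 \<le> k \<Longrightarrow> post_norm \<alpha> \<omega> \<le> ennreal (chord \<alpha> k (pmax \<omega>))"
    and "1 \<le> k \<Longrightarrow> 0 \<le> chord \<alpha> k (pmax \<omega>)"
proof -
  have le: "post x \<omega> powr \<alpha> \<le> post x \<omega>" if "x \<in> A" for x
    using powr_mono'[of 1 \<alpha> "post x \<omega>"] post_nonneg[OF that] post_le_1[OF that] assms by simp
  have "(\<lambda>x. post x \<omega> powr \<alpha>) summable_on A"
    by (rule summable_on_comparison_test[of "\<lambda>x. post x \<omega>"])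
      (use le post_has_sum[of \<omega>] in \<open>auto simp: summable_on_def\<close>)
  then obtain S where S: "((\<lambda>x. post x \<omega> powr \<alpha>) has_sum S) A"
    by (auto simp: summable_on_def)
  note eq = post_norm_eq[OF S]
  have S0: "0 \<le> S" using S by (rule has_sum_nonneg) simp
  have "S \<le> 1" using S post_has_sum le by (rule has_sum_mono)
  then have "S powr (1 / \<alpha>) \<le> 1 powr (1 / \<alpha>)" using S0 assms by (intro powr_mono2) auto
  then show "post_norm \<alpha> \<omega> \<le> 1" by (simp add: eq ennreal_le_1)
  obtain x where x: "x \<in> A" "post x \<omega> = pmax \<omega>" by (rule pmax_attained)
  have "pmax \<omega> powr \<alpha> \<le> S"
    using has_sum_mono2[OF has_sum_finite[of "{x}"] S] x by auto
  then have "(pmax \<omega> powr \<alpha>) powr (1 / \<alpha>) \<le> S powr (1 / \<alpha>)" using assms by (intro powr_mono2) auto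
  then show "ennreal (pmax \<omega>) \<le> post_norm \<alpha> \<omega>"
    using assms pmax_pos[of \<omega>] by (simp add: eq powr_powr ennreal_leI)
  assume k: "1 \<le> k"
  have *: "S powr (1 / \<alpha>) \<le> chord \<alpha> k (pmax \<omega>)"
    using chord_bound_post[OF _ _ k S] assms by simp
  then show "post_norm \<alpha> \<omega> \<le> ennreal (chord \<alpha> k (pmax \<omega>))"
    by (simp add: eq ennreal_leI)
  show "0 \<le> chord \<alpha> k (pmax \<omega>)" using * powr_ge_zero order_trans by blast
qed

text \<open>An infinite norm satisfies this trivially; otherwise the sign factor in the chord bound
  is \<open>- 1\<close> and turns it into a lower bound.\<close>

lemma post_norm_less1:
  assumes "0 < \<alpha>" "\<alpha> < 1" "1 \<le> k"
  shows "ennreal (chord \<alpha> k (pmax \<omega>)) \<le> post_norm \<alpha> \<omega>"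
proof (cases "(\<Sum>\<^sub>\<infinity>x\<in>A. ennreal (post x \<omega> powr \<alpha>)) = \<infinity>")
  case True
  then show ?thesis by (simp add: post_norm_def ennreal_powr_def)
next
  case False
  then have "(\<lambda>x. post x \<omega> powr \<alpha>) summable_on A"
    by (intro summable_on_if_infsum_ennreal_finite) auto
  then obtain S where S: "((\<lambda>x. post x \<omega> powr \<alpha>) has_sum S) A"
    by (auto simp: summable_on_def)
  have "chord \<alpha> k (pmax \<omega>) \<le> S powr (1 / \<alpha>)"
    using chord_bound_post[OF _ _ assms(3) S] assms by simp
  then show ?thesis by (simp add: post_norm_eq[OF S] ennreal_leI)
qed

abbreviation "exp_pmax \<equiv> \<integral>\<omega>. pmax \<omega> \<partial>M"

lemma integrable_chord: "integrable M (\<lambda>\<omega>. chord \<alpha> k (pmax \<omega>))"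
  unfolding chord_def using integrable_pmax by simp

text \<open>The chord is affine in \<open>m\<close>, so the pointwise bound becomes one in the
  expected maximum alone.\<close>

lemma integral_chord: "(\<integral>\<omega>. chord \<alpha> k (pmax \<omega>) \<partial>M) = chord \<alpha> k exp_pmax"
  unfolding chord_def using integrable_pmax by (simp add: prob_space)

lemma exp_pmax_bounds: "0 < exp_pmax" "exp_pmax \<le> 1"
proof -
  have "(\<integral>\<omega>. 0 \<partial>M) < exp_pmax"
    using integrable_pmax pmax_pos emeasure_space_1
    by (intro integral_less_AE_space) auto
  then show "0 < exp_pmax" by simp
  have "exp_pmax \<le> (\<integral>\<omega>. 1 \<partial>M)"
    by (intro integral_mono integrable_pmax pmax_le_1) auto
  then show "exp_pmax \<le> 1" by (simp add: prob_space)
qed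

lemma expectation_post_norm_gt1:
  assumes "1 < \<alpha>"
  obtains i where "(\<integral>\<^sup>+\<omega>. post_norm \<alpha> \<omega> \<partial>M) = ennreal i" "exp_pmax \<le> i" "i \<le> 1"
    "\<And>k. 1 \<le> k \<Longrightarrow> i \<le> chord \<alpha> k exp_pmax"
proof -
  have "(\<integral>\<^sup>+\<omega>. post_norm \<alpha> \<omega> \<partial>M) \<le> (\<integral>\<^sup>+\<omega>. 1 \<partial>M)"
    by (intro nn_integral_mono post_norm_gt1(2) assms)
  then have le1: "(\<integral>\<^sup>+\<omega>. post_norm \<alpha> \<omega> \<partial>M) \<le> 1" by (simp add: emeasure_space_1)
  then obtain i where i: "(\<integral>\<^sup>+\<omega>. post_norm \<alpha> \<omega> \<partial>M) = ennreal i" "0 \<le> i"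
    by (cases "\<integral>\<^sup>+\<omega>. post_norm \<alpha> \<omega> \<partial>M") (auto simp: top_unique)
  have "ennreal exp_pmax \<le> (\<integral>\<^sup>+\<omega>. ennreal (pmax \<omega>) \<partial>M)"
    by (rule ennreal_integral_le_nn_integral[OF integrable_pmax])
  also have "\<dots> \<le> ennreal i"
    unfolding i(1)[symmetric] by (intro nn_integral_mono post_norm_gt1(1) assms)
  finally have 1: "exp_pmax \<le> i" using i by (simp add: ennreal_le_iff)
  have 2: "i \<le> chord \<alpha> k exp_pmax" if k: "1 \<le> k" for k
  proof -
    have "ennreal i \<le> (\<integral>\<^sup>+\<omega>. ennreal (chord \<alpha> k (pmax \<omega>)) \<partial>M)"
      unfolding i(1)[symmetric] by (intro nn_integral_mono post_norm_gt1(3) assms k)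
    also have "\<dots> = ennreal (chord \<alpha> k exp_pmax)"
      unfolding integral_chord[symmetric]
      by (intro nn_integral_eq_integral integrable_chord AE_I2 post_norm_gt1(4) assms k)
    finally have "ennreal i \<le> ennreal (chord \<alpha> k exp_pmax)" .
    moreover have "0 \<le> chord \<alpha> k exp_pmax"
      unfolding integral_chord[symmetric]
      by (intro integral_nonneg_AE AE_I2 post_norm_gt1(4) assms k)
    ultimately show ?thesis by (simp add: ennreal_le_iff)
  qed
  show thesis by (rule that[OF i(1) 1 _ 2]) (use le1 i in \<open>auto simp: ennreal_le_1\<close>)
qed

text \<open>The sign factor lets one statement carry the upper bound for \<open>\<alpha> > 1\<close>
  and the lower bound for \<open>\<alpha> < 1\<close>.\<close>

lemma chord_bound_expectation:
  assumes "0 < \<alpha>" "\<alpha> \<noteq> 1" "1 \<le> k" "(\<integral>\<^sup>+\<omega>. post_norm \<alpha> \<omega> \<partial>M) = ennreal i" "0 \<le> i"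
  shows "sgn (\<alpha> - 1) * i \<le> sgn (\<alpha> - 1) * chord \<alpha> k exp_pmax"
proof (cases "1 < \<alpha>")
  case True
  then obtain j where "ennreal i = ennreal j" "exp_pmax \<le> j" "j \<le> chord \<alpha> k exp_pmax"
    using expectation_post_norm_gt1[OF True] assms by metis
  then show ?thesis using True exp_pmax_bounds assms(5) by simp
next
  case False
  have "ennreal (chord \<alpha> k exp_pmax) \<le> (\<integral>\<^sup>+\<omega>. ennreal (chord \<alpha> k (pmax \<omega>)) \<partial>M)"
    unfolding integral_chord[symmetric] by (rule ennreal_integral_le_nn_integral[OF integrable_chord])
  also have "\<dots> \<le> ennreal i"
    unfolding assms(4)[symmetric] using False assms by (intro nn_integral_mono post_norm_less1) auto
  finally show ?thesis using False assms by (simp add: ennreal_le_iff)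
qed

lemma min_error_prob_le_entropy_error_bound:
  assumes b: "1 < b" and \<alpha>: "0 < \<alpha>" "\<alpha> \<noteq> 1" and k: "1 \<le> k"
    and fin: "\<bar>arimoto_renyi_cond_entropy b M A N \<alpha> X Y\<bar> \<noteq> \<infinity>"
  shows "min_error_prob M A N X Y \<le>
    entropy_error_bound b \<alpha> k (real_of_ereal (arimoto_renyi_cond_entropy b M A N \<alpha> X Y))"
proof -
  obtain i where i: "0 < i" "(\<integral>\<^sup>+\<omega>. post_norm \<alpha> \<omega> \<partial>M) = ennreal i"
    "arimoto_renyi_cond_entropy b M A N \<alpha> X Y = ereal (\<alpha> / (1 - \<alpha>) * log b i)"
    using finite_scaled_ennreal_logE[OF fin[unfolded arimoto_renyi_cond_entropy_eq]] \<alpha>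
    unfolding arimoto_renyi_cond_entropy_eq by auto
  have sgn: "sgn (chord_slope \<alpha> k) = - sgn (\<alpha> - 1)" by (rule chord_slope_sign[OF \<alpha> k])
  then have nz: "chord_slope \<alpha> k \<noteq> 0" using \<alpha> by (auto simp: sgn_if split: if_splits)
  have "sgn (\<alpha> - 1) * i \<le> sgn (\<alpha> - 1) * chord \<alpha> k exp_pmax"
    using chord_bound_expectation[OF \<alpha> k i(2)] i(1) by simp
  \<comment> \<open>Unless the numerator vanishes, numerator and denominator both have the sign
    opposite to that of \<open>\<alpha> - 1\<close>.\<close>
  then have "0 \<le> (i - chord \<alpha> k exp_pmax) / chord_slope \<alpha> k"
    using sgn \<alpha> by (auto simp: sgn_if zero_le_divide_iff split: if_splits)
  then show ?thesis
    unfolding min_error_prob_eq i(3) entropy_error_bound_eq[OF nz k, where m = exp_pmax]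
    using powr_scaled_log(1)[OF b i(1) \<alpha>] by simp
qed

lemma entropy_error_bound_tendsto:
  assumes b: "1 < b"
  defines "H \<equiv> \<lambda>\<alpha>. arimoto_renyi_cond_entropy b M A N \<alpha> X Y"
  shows "\<exists>\<kappa>::real \<Rightarrow> nat.
    (\<forall>\<alpha>>1. \<forall>k. (1 \<le> k \<and> ereal (log b (real k)) \<le> H \<alpha> \<and> H \<alpha> < ereal (log b (real k + 1)))
       \<longleftrightarrow> k = \<kappa> \<alpha>) \<and>
    ((\<lambda>\<alpha>. entropy_error_bound b \<alpha> (\<kappa> \<alpha>) (real_of_ereal (H \<alpha>)))
       \<longlongrightarrow> min_error_prob M A N X Y) at_top"
proof -
  define i where "i \<alpha> = enn2real (\<integral>\<^sup>+\<omega>. post_norm \<alpha> \<omega> \<partial>M)" for \<alpha>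
  have i: "(\<integral>\<^sup>+\<omega>. post_norm \<alpha> \<omega> \<partial>M) = ennreal (i \<alpha>)" "exp_pmax \<le> i \<alpha>" "i \<alpha> \<le> 1"
    "i \<alpha> \<le> chord \<alpha> 1 exp_pmax" if \<alpha>: "1 < \<alpha>" for \<alpha>
  proof -
    obtain j where j: "(\<integral>\<^sup>+\<omega>. post_norm \<alpha> \<omega> \<partial>M) = ennreal j" "exp_pmax \<le> j" "j \<le> 1"
      "j \<le> chord \<alpha> 1 exp_pmax"
      using expectation_post_norm_gt1[OF \<alpha>] by (metis order_refl)
    moreover have "i \<alpha> = j" using j exp_pmax_bounds by (simp add: i_def)
    ultimately show "(\<integral>\<^sup>+\<omega>. post_norm \<alpha> \<omega> \<partial>M) = ennreal (i \<alpha>)" "exp_pmax \<le> i \<alpha>" "i \<alpha> \<le> 1"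
      "i \<alpha> \<le> chord \<alpha> 1 exp_pmax" by simp_all
  qed
  have i_pos: "0 < i \<alpha>" if "1 < \<alpha>" for \<alpha> using i(2)[OF that] exp_pmax_bounds by linarith
  define h where "h \<alpha> = \<alpha> / (1 - \<alpha>) * log b (i \<alpha>)" for \<alpha>
  have H: "H \<alpha> = ereal (h \<alpha>)" if "1 < \<alpha>" for \<alpha>
    using i_pos[OF that] unfolding H_def arimoto_renyi_cond_entropy_eq i(1)[OF that]
    by (simp add: h_def ennreal_log_def)
  have bh: "b powr h \<alpha> = i \<alpha> powr (\<alpha> / (1 - \<alpha>))" if "1 < \<alpha>" for \<alpha>
    using powr_scaled_log(2)[OF b i_pos[OF that]] that by (simp add: h_def)
  \<comment> \<open>The base \<open>i \<alpha>\<close> is at most \<open>1\<close> and the exponent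
    is negative. This makes the integer part below at least \<open>1\<close>.\<close>
  have bh_ge: "1 \<le> b powr h \<alpha>" if "1 < \<alpha>" for \<alpha>
  proof -
    have "i \<alpha> powr 0 \<le> i \<alpha> powr (\<alpha> / (1 - \<alpha>))"
      using that i_pos[OF that] i(3)[OF that] by (intro powr_mono') (auto simp: divide_le_0_iff)
    then show ?thesis using bh that i_pos[OF that] by simp
  qed
  \<comment> \<open>The condition \<open>log k \<le> H < log (k + 1)\<close> says that
    \<open>k\<close> is the integer part of the exponential of the entropy.\<close>
  define \<kappa> where "\<kappa> \<alpha> = nat \<lfloor>b powr h \<alpha>\<rfloor>" for \<alpha>
  have \<kappa>: "(1 \<le> k \<and> ereal (log b (real k)) \<le> H \<alpha> \<and> H \<alpha> < ereal (log b (real k + 1))) \<longleftrightarrow> k = \<kappa> \<alpha>"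
    if "1 < \<alpha>" for \<alpha> k
  proof -
    have "1 \<le> k \<and> ereal (log b (real k)) \<le> H \<alpha> \<and> H \<alpha> < ereal (log b (real k + 1))
      \<longleftrightarrow> 1 \<le> k \<and> real k \<le> b powr h \<alpha> \<and> b powr h \<alpha> < real k + 1"
      unfolding H[OF that] using b by (auto simp: log_le_iff less_log_iff)
    also have "\<dots> \<longleftrightarrow> 1 \<le> k \<and> \<lfloor>b powr h \<alpha>\<rfloor> = int k"
      by (auto simp: floor_eq_iff)
    also have "\<dots> \<longleftrightarrow> k = \<kappa> \<alpha>"
      using bh_ge[OF that] by (auto simp: \<kappa>_def le_nat_iff le_floor_iff)
    finally show ?thesis .
  qed
  have ev1: "\<forall>\<^sub>F \<alpha>::real in at_top. 1 < \<alpha>" by (rule eventually_gt_at_top)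
  \<comment> \<open>The expected norm is squeezed between the expected maximum and the chord for
    \<open>k = 1\<close>, which tends to it.\<close>
  have i_lim: "(i \<longlongrightarrow> exp_pmax) at_top"
  proof (rule tendsto_sandwich)
    show "\<forall>\<^sub>F \<alpha> in at_top. exp_pmax \<le> i \<alpha>" using ev1 by eventually_elim (rule i(2))
    show "\<forall>\<^sub>F \<alpha> in at_top. i \<alpha> \<le> chord \<alpha> 1 exp_pmax" using ev1 by eventually_elim (rule i(4))
  qed (use chord_tendsto in auto)
  have "((\<lambda>\<alpha>. entropy_error_bound b \<alpha> (\<kappa> \<alpha>) (h \<alpha>)) \<longlongrightarrow> 1 - exp_pmax) at_top"
  proof (rule tendsto_finite_choice[where f = "\<lambda>k \<alpha>. entropy_error_bound b \<alpha> k (h \<alpha>)"])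
    \<comment> \<open>For \<open>\<alpha> \<ge> 2\<close> the exponent
      \<open>\<alpha> / (1 - \<alpha>)\<close> is at least \<open>- 2\<close>. With
      \<open>exp_pmax \<le> i \<alpha> \<le> 1\<close> the exponential of the entropy is then at
      most \<open>exp_pmax powr - 2\<close>.\<close>
    show "finite {1..nat \<lfloor>exp_pmax powr - 2\<rfloor>}" by simp
    fix k assume "k \<in> {1..nat \<lfloor>exp_pmax powr - 2\<rfloor>}"
    then have k: "1 \<le> k" by simp
    have "((\<lambda>\<alpha>. 1 - exp_pmax + (i \<alpha> - chord \<alpha> k exp_pmax) / chord_slope \<alpha> k)
        \<longlongrightarrow> 1 - exp_pmax + (exp_pmax - exp_pmax) / (- 1)) at_top"
      by (intro tendsto_intros i_lim chord_tendsto chord_slope_tendsto k) simp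
    moreover have "\<forall>\<^sub>F \<alpha> in at_top. entropy_error_bound b \<alpha> k (h \<alpha>) =
        1 - exp_pmax + (i \<alpha> - chord \<alpha> k exp_pmax) / chord_slope \<alpha> k"
      using ev1
    proof eventually_elim
      case (elim \<alpha>)
      then have "chord_slope \<alpha> k \<noteq> 0"
        using chord_slope_sign[of \<alpha> k] k by (auto simp: sgn_if split: if_splits)
      from entropy_error_bound_eq[OF this k, of b "h \<alpha>" exp_pmax] show ?case
        using powr_scaled_log(1)[OF b i_pos[OF elim], of \<alpha>] elim by (simp add: h_def)
    qed
    ultimately show "((\<lambda>\<alpha>. entropy_error_bound b \<alpha> k (h \<alpha>)) \<longlongrightarrow> 1 - exp_pmax) at_top"
      by (simp add: filterlim_cong)
  next
    show "\<forall>\<^sub>F \<alpha> in at_top. \<kappa> \<alpha> \<in> {1..nat \<lfloor>exp_pmax powr - 2\<rfloor>}"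
      using eventually_ge_at_top[of 2]
    proof eventually_elim
      case (elim \<alpha>)
      then have \<alpha>: "1 < \<alpha>" by simp
      have "b powr h \<alpha> = i \<alpha> powr (\<alpha> / (1 - \<alpha>))" by (rule bh[OF \<alpha>])
      also have "\<dots> \<le> i \<alpha> powr - 2"
        using i_pos[OF \<alpha>] i(3)[OF \<alpha>] elim by (intro powr_mono') (auto simp: field_simps)
      also have "\<dots> \<le> exp_pmax powr - 2"
        using i(2)[OF \<alpha>] exp_pmax_bounds by (intro powr_mono2') auto
      finally have "\<kappa> \<alpha> \<le> nat \<lfloor>exp_pmax powr - 2\<rfloor>"
        unfolding \<kappa>_def by (intro nat_mono floor_mono)
      moreover have "1 \<le> \<kappa> \<alpha>" using \<kappa>[OF \<alpha>, of "\<kappa> \<alpha>"] by simp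
      ultimately show ?case by simp
    qed
  qed
  moreover have "\<forall>\<^sub>F \<alpha> in at_top. entropy_error_bound b \<alpha> (\<kappa> \<alpha>) (h \<alpha>) =
      entropy_error_bound b \<alpha> (\<kappa> \<alpha>) (real_of_ereal (H \<alpha>))"
    using ev1 by eventually_elim (simp add: H)
  ultimately have "((\<lambda>\<alpha>. entropy_error_bound b \<alpha> (\<kappa> \<alpha>) (real_of_ereal (H \<alpha>)))
      \<longlongrightarrow> min_error_prob M A N X Y) at_top"
    unfolding min_error_prob_eq by (rule Lim_transform_eventually)
  with \<kappa> show ?thesis by blast
qed

end

theorem theorem12:
  fixes b :: real
    and M :: "'a measure" and N :: "'y measure" and A :: "'x set"
    and X :: "'a \<Rightarrow> 'x" and Y :: "'a \<Rightarrow> 'y"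
  assumes "1 < b"
    and "prob_space M"
    and "countable A"
    and "X \<in> M \<rightarrow>\<^sub>M count_space A"
    and "Y \<in> M \<rightarrow>\<^sub>M N"
  defines "H \<equiv> \<lambda>\<alpha>. arimoto_renyi_cond_entropy b M A N \<alpha> X Y"
  shows "(\<forall>k::nat. \<forall>\<alpha>::real. 1 \<le> k \<longrightarrow> \<alpha> \<in> {0<..<1} \<union> {1<..} \<longrightarrow>
            ereal (log b (real k)) \<le> H \<alpha> \<and> H \<alpha> < ereal (log b (real k + 1)) \<longrightarrow>
            min_error_prob M A N X Y \<le> entropy_error_bound b \<alpha> k (real_of_ereal (H \<alpha>))) \<and>
         (\<exists>\<kappa> :: real \<Rightarrow> nat.
            (\<forall>\<alpha>>1. \<forall>k. (1 \<le> k \<and> ereal (log b (real k)) \<le> H \<alpha> \<and> H \<alpha> < ereal (log b (real k + 1)))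
                       \<longleftrightarrow> k = \<kappa> \<alpha>) \<and>
            ((\<lambda>\<alpha>. entropy_error_bound b \<alpha> (\<kappa> \<alpha>) (real_of_ereal (H \<alpha>)))
               \<longlongrightarrow> min_error_prob M A N X Y) at_top)"
proof -
  interpret guessing M A N X Y
    using assms by (auto simp: guessing_def guessing_axioms_def)
  show ?thesis
  proof (intro conjI allI impI)
    fix k :: nat and \<alpha> :: real
    assume k: "1 \<le> k" and \<alpha>: "\<alpha> \<in> {0<..<1} \<union> {1<..}"
      and h: "ereal (log b (real k)) \<le> H \<alpha> \<and> H \<alpha> < ereal (log b (real k + 1))"
    \<comment> \<open>Two real bounds enclose the entropy, so \<open>real_of_ereal\<close> returns
      its true value.\<close>
    have "\<bar>H \<alpha>\<bar> \<noteq> \<infinity>" using h by (cases "H \<alpha>") auto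
    then show "min_error_prob M A N X Y \<le> entropy_error_bound b \<alpha> k (real_of_ereal (H \<alpha>))"
      unfolding H_def using assms(1) \<alpha> k by (intro min_error_prob_le_entropy_error_bound) auto
  qed (use entropy_error_bound_tendsto[OF assms(1)] in \<open>simp add: H_def\<close>)
qed

end
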